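(* Let $\rightsquigarrow$ be a semi-3-eternal relation, $G$ a finite group, $p$ a prime divisor of $|G|$, and $S$ a Sylow $p$-subgroup of $G$. Suppose that every subgroup $H$ of $S$ of order $p$ satisfies $H\rightsquigarrow G$ and, if $S$ is a non-cyclic $2$-group, every cyclic subgroup $H$ of $S$ of order $4$ satisfies $H\rightsquigarrow G$. Then $\mathcal{F}_S(G)$ is supersolvable.
   Context: All groups are finite. $Z_{\mathfrak{U}}(G)$ denotes the supersolvable hypercenter of $G$: the largest normal subgroup $N$ of $G$ such that every chief factor of $G$ below $N$ is cyclic (of prime order). Let $\rightsquigarrow$ be a relation, defined for every finite group $G$, between subgroups $H\le G$ and $G$ (written $H\rightsquigarrow G$). It is called semi-3-eternal if for every finite group $G$ the following hold: (0) for all subgroups $H\le K\le G$, if $H\rightsquigarrow G$ then $H\rightsquigarrow K$; (3') for every prime divisor $p$ of $|G|$: if every subgroup $H$ of $O_p(G)$ of order $p$ satisfies $H\rightsquigarrow G$ and, in case $O_p(G)$ is a non-cyclic $2$-group, every cyclic subgroup $H$ of $O_p(G)$ of order $4$ satisfies $H\rightsquigarrow G$, then $O_p(G)\le Z_{\mathfrak{U}}(G)$. $\mathcal{F}_S(G)$ is the (saturated) fusion system on $S\in\mathrm{Syl}_p(G)$ whose objects are the subgroups of $S$ and whose morphisms $P\to Q$ are the maps $x\mapsto x^g$ with $g\in G$, $P^g\le Q$. A saturated fusion system $\mathcal{F}$ on a $p$-group $S$ is supersolvable if there is a series $1=S_0\le S_1\le\cdots\le S_n=S$ of strongly $\mathcal{F}$-closed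 subgroups of $S$ with $S_{i+1}/S_i$ cyclic for $0\le i\le n-1$. (A subgroup $T\le S$ is strongly $\mathcal{F}$-closed if for every $P\le T$ and every $\phi\in\mathrm{Hom}_{\mathcal{F}}(P,S)$ one has $P^{\phi}\le T$.) *)

theory Defs
  imports "HOL-Algebra.Algebra" "HOL-Computational_Algebra.Primes"
begin

abbreviation subgrp :: "('a, 'b) monoid_scheme \<Rightarrow> 'a set \<Rightarrow> ('a, 'b) monoid_scheme" where
  "subgrp G H \<equiv> G\<lparr>carrier := H\<rparr>"

definition p_subgroup :: "nat \<Rightarrow> ('a, 'b) monoid_scheme \<Rightarrow> 'a set \<Rightarrow> bool" where
  "p_subgroup p G H \<longleftrightarrow> subgroup H G \<and> (\<exists>k. card H = p ^ k)"

definition sylow_subgroup :: "nat \<Rightarrow> ('a, 'b) monoid_scheme \<Rightarrow> 'a set \<Rightarrow> bool" where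
  "sylow_subgroup p G S \<longleftrightarrow> subgroup S G \<and> card S = p ^ multiplicity p (order G)"

text \<open>\<open>O\<^sub>p(G)\<close>, the largest normal \<open>p\<close>-subgroup.\<close>

definition p_core :: "nat \<Rightarrow> ('a, 'b) monoid_scheme \<Rightarrow> 'a set" where
  "p_core p G = (GREATEST N. N \<lhd> G \<and> p_subgroup p G N)"

definition chief_factor :: "('a, 'b) monoid_scheme \<Rightarrow> 'a set \<Rightarrow> 'a set \<Rightarrow> bool" where
  "chief_factor G H K \<longleftrightarrow>
     H \<lhd> G \<and> K \<lhd> G \<and> K \<subset> H \<and> \<not> (\<exists>L. L \<lhd> G \<and> K \<subset> L \<and> L \<subset> H)"

text \<open>A cyclic chief factor of a finite group automatically has prime order.\<close>

definition supersolvable_hypercenter :: "('a, 'b) monoid_scheme \<Rightarrow> 'a set" where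
  "supersolvable_hypercenter G =
     (GREATEST N. N \<lhd> G \<and>
        (\<forall>H K. chief_factor G H K \<and> H \<subseteq> N \<longrightarrow> cyclic_group (subgrp G H Mod K)))"

text \<open>
  A relation between subgroups \<open>H\<close> of finite groups \<open>G\<close> and \<open>G\<close> itself is a predicate
  \<open>R H G\<close>; its values when \<open>H\<close> is not a subgroup of a finite group \<open>G\<close> are never used.
  All groups involved have elements in one (arbitrary) type \<open>'a\<close>.  This is no loss: a relation
  given only for the groups over \<open>'a\<close> extends to all finite groups by letting it fail
  elsewhere, and this preserves both conditions below, since the second one holds
  trivially for a group none of whose subgroups is related to it (if \<open>O\<^sub>p(G)\<close> is nontrivial, it
  contains a subgroup of order \<open>p\<close>, so the premise is false).
\<close>

definition semi_3_eternal :: "('a set \<Rightarrow> 'a monoid \<Rightarrow> bool) \<Rightarrow> bool" where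
  "semi_3_eternal R \<longleftrightarrow>
     (\<forall>G :: 'a monoid. group G \<and> finite (carrier G) \<longrightarrow>
        (\<forall>H K. subgroup K G \<and> subgroup H (subgrp G K) \<and> R H G \<longrightarrow> R H (subgrp G K)) \<and>
        (\<forall>p. Factorial_Ring.prime p \<and> p dvd order G \<and>
             (\<forall>H. subgroup H (subgrp G (p_core p G)) \<and> card H = p \<longrightarrow> R H G) \<and>
             (\<not> cyclic_group (subgrp G (p_core p G)) \<and> p_subgroup 2 G (p_core p G) \<longrightarrow>
               (\<forall>H. subgroup H (subgrp G (p_core p G)) \<and> cyclic_group (subgrp G H) \<and> card H = 4
                  \<longrightarrow> R H G))
           \<longrightarrow> p_core p G \<subseteq> supersolvable_hypercenter G))"

text \<open>
  A fusion system on a group \<open>S\<close> is represented by its morphism sets: \<open>F P Q\<close> is the set of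
  morphisms from \<open>P\<close> to \<open>Q\<close>, each made extensional outside \<open>P\<close>, for subgroups \<open>P\<close>, \<open>Q\<close>
  of \<open>S\<close>.  Maps act on the right in the source, so \<open>x\<^sup>g\<close> is \<open>g\<inverse> x g\<close>.
\<close>

type_synonym 'a fusion = "'a set \<Rightarrow> 'a set \<Rightarrow> ('a \<Rightarrow> 'a) set"

definition group_fusion :: "('a, 'b) monoid_scheme \<Rightarrow> 'a set \<Rightarrow> 'a fusion" where
  "group_fusion G S P Q =
     {\<phi>. subgroup P (subgrp G S) \<and> subgroup Q (subgrp G S) \<and>
         (\<exists>g \<in> carrier G. \<phi> = (\<lambda>x\<in>P. inv\<^bsub>G\<^esub> g \<otimes>\<^bsub>G\<^esub> x \<otimes>\<^bsub>G\<^esub> g) \<and> \<phi> ` P \<subseteq> Q)}"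

definition strongly_closed :: "('a, 'b) monoid_scheme \<Rightarrow> 'a fusion \<Rightarrow> 'a set \<Rightarrow> bool" where
  "strongly_closed S F T \<longleftrightarrow> subgroup T S \<and>
     (\<forall>P. subgroup P (subgrp S T) \<longrightarrow> (\<forall>\<phi> \<in> F P (carrier S). \<phi> ` P \<subseteq> T))"

text \<open>
  Normality of \<open>T i\<close> in \<open>T (Suc i)\<close> is automatic for a fusion system, whose morphisms
  include conjugation by elements of \<open>S\<close>; it is spelled out so that the quotient makes sense
  for an arbitrary \<open>F\<close>.  Supersolvability is only considered for saturated \<open>F\<close>; saturation
  is not part of the property.
\<close>

definition supersolvable_fusion :: "('a, 'b) monoid_scheme \<Rightarrow> 'a fusion \<Rightarrow> bool" where
  "supersolvable_fusion S F \<longleftrightarrow>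
     (\<exists>(n :: nat) T. T 0 = {\<one>\<^bsub>S\<^esub>} \<and> T n = carrier S \<and>
        (\<forall>i\<le>n. strongly_closed S F (T i)) \<and>
        (\<forall>i<n. T i \<lhd> subgrp S (T (Suc i)) \<and> cyclic_group (subgrp S (T (Suc i)) Mod T i)))"

end

theory Submission
  imports Defs "HOL-Number_Theory.Residues"
begin

text \<open>
  If \<open>L \<le> G\<close> and \<open>S \<inter> L\<close> is a Sylow subgroup of \<open>L\<close>, then the hypothesis restricts to \<open>L\<close>, so every
  chief factor of \<open>L\<close> below \<open>O\<^sub>p(L)\<close> is cyclic.  Take \<open>L = N\<^sub>G(Q)\<close> for a fully normalized \<open>Q \<le> S\<close>.
  The elements of \<open>L\<close> acting trivially on all chief factors below \<open>Q\<close> include all \<open>p\<close>-elements, and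
  those among them of order prime to \<open>p\<close> centralize \<open>Q\<close>.  Hence \<open>N\<^sub>S(Q) C\<^sub>L(Q)\<close> is normal in \<open>L\<close>, and by a
  Frattini argument every automorphism of \<open>Q\<close> induced by \<open>L\<close> extends to \<open>N\<^sub>S(Q)\<close>.  Since normalizers
  grow in \<open>S\<close>, induction on the index shows that \<open>N\<^sub>G(S)\<close> controls the fusion in \<open>S\<close>.  Therefore the
  normal subgroups of \<open>N\<^sub>G(S)\<close> inside \<open>S\<close> are strongly closed, and a chief series of \<open>N\<^sub>G(S)\<close> below \<open>S\<close>,
  whose factors are cyclic, is the required series.
\<close>

section \<open>Conjugation\<close>

text \<open>The defining condition of a semi-3-eternal relation speaks only about O_p of the group
  to which it is applied, and O_p(G) may be trivial. Information about \<open>S\<close> therefore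
  has to be collected from local subgroups \<open>L\<close>. The Sylow condition on
  \<open>S \<inter> L\<close> is what makes this possible: O_p(L) lies in every Sylow p-subgroup of
  \<open>L\<close>, hence in \<open>S\<close>, where the hypothesis applies. Its clause for order 4
  also passes to \<open>L\<close>, since a non-cyclic O_p(L) forces \<open>S\<close> to be
  non-cyclic.

  The p-elements act trivially because a cyclic chief factor of p-power order has order p, and an
  automorphism group of order p - 1 contains no nontrivial p-element. The centralizer is the slack
  in the Frattini argument: \<open>l\<close> and \<open>l \<otimes> c\<close> induce the same map on
  \<open>Q\<close>, but \<open>c\<close> can be chosen so that the second one normalizes
  \<open>S \<inter> normalizer_of G Q\<close>, on which the induction hypothesis then applies.

  The hypercenter is given as a greatest element. That this element exists is itself a fact about
  chief factors: a product of two normal subgroups with cyclic chief factors below them again has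
  this property.\<close>

definition conjugate :: "('a, 'b) monoid_scheme \<Rightarrow> 'a \<Rightarrow> 'a \<Rightarrow> 'a" where
  "conjugate G g x = inv\<^bsub>G\<^esub> g \<otimes>\<^bsub>G\<^esub> x \<otimes>\<^bsub>G\<^esub> g"

definition centralizer_of :: "('a, 'b) monoid_scheme \<Rightarrow> 'a set \<Rightarrow> 'a set" where
  "centralizer_of G Q = {g \<in> carrier G. \<forall>x\<in>Q. conjugate G g x = x}"

definition normalizer_of :: "('a, 'b) monoid_scheme \<Rightarrow> 'a set \<Rightarrow> 'a set" where
  "normalizer_of G Q = {g \<in> carrier G. conjugate G g ` Q = Q}"

context group
begin

lemma conjugate_closed [simp]: "g \<in> carrier G \<Longrightarrow> x \<in> carrier G \<Longrightarrow> conjugate G g x \<in> carrier G"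
  by (simp add: conjugate_def)

lemma conjugate_one [simp]: "x \<in> carrier G \<Longrightarrow> conjugate G \<one> x = x"
  by (simp add: conjugate_def)

lemma conjugate_of_one [simp]: "g \<in> carrier G \<Longrightarrow> conjugate G g \<one> = \<one>"
  by (simp add: conjugate_def)

text \<open>Conjugation is a right action, as in \<open>group_fusion\<close>: in
  \<open>g \<otimes> h\<close> the element \<open>g\<close> acts first. All products of conjugating
  elements below are to be read in this order.\<close>

lemma conjugate_conjugate:
  "g \<in> carrier G \<Longrightarrow> h \<in> carrier G \<Longrightarrow> x \<in> carrier G \<Longrightarrow>
    conjugate G (g \<otimes> h) x = conjugate G h (conjugate G g x)"
  by (simp add: conjugate_def inv_mult_group m_assoc)

lemma conjugate_inv_cancel [simp]:
  assumes "g \<in> carrier G" "x \<in> carrier G"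
  shows "conjugate G (inv g) (conjugate G g x) = x" "conjugate G g (conjugate G (inv g) x) = x"
  using assms by (simp_all flip: conjugate_conjugate)

lemma conjugate_mult:
  assumes "g \<in> carrier G" "x \<in> carrier G" "y \<in> carrier G"
  shows "conjugate G g (x \<otimes> y) = conjugate G g x \<otimes> conjugate G g y"
proof -
  have "g \<otimes> (inv g \<otimes> (y \<otimes> g)) = y \<otimes> g"
    using assms by (simp flip: m_assoc)
  then show ?thesis
    using assms by (simp add: conjugate_def m_assoc)
qed

lemma conjugate_group_hom: "g \<in> carrier G \<Longrightarrow> group_hom G G (conjugate G g)"
  by (intro group_hom.intro group_hom_axioms.intro is_group homI) (simp_all add: conjugate_mult)

lemma inj_on_conjugate: "g \<in> carrier G \<Longrightarrow> A \<subseteq> carrier G \<Longrightarrow> inj_on (conjugate G g) A"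
  by (rule inj_onI) (metis conjugate_inv_cancel(1) subsetD)

lemma card_conjugate: "g \<in> carrier G \<Longrightarrow> A \<subseteq> carrier G \<Longrightarrow> card (conjugate G g ` A) = card A"
  by (simp add: card_image inj_on_conjugate)

lemma subgroup_conjugate:
  "g \<in> carrier G \<Longrightarrow> subgroup H G \<Longrightarrow> subgroup (conjugate G g ` H) G"
  by (rule group_hom.subgroup_img_is_subgroup[OF conjugate_group_hom])

lemma conjugate_image_mult:
  assumes "g \<in> carrier G" "h \<in> carrier G" "A \<subseteq> carrier G"
  shows "conjugate G (g \<otimes> h) ` A = conjugate G h ` conjugate G g ` A"
  unfolding image_image using assms by (intro image_cong) (simp_all add: conjugate_conjugate subset_iff)

lemma conjugate_image_one [simp]: "A \<subseteq> carrier G \<Longrightarrow> conjugate G \<one> ` A = A"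
  by (simp add: subset_iff cong: image_cong)

lemma conjugate_subgrp:
  "subgroup H G \<Longrightarrow> g \<in> H \<Longrightarrow> conjugate (subgrp G H) g x = conjugate G g x"
  by (simp add: conjugate_def m_inv_consistent)

lemma conjugate_in_subgroup: "subgroup H G \<Longrightarrow> g \<in> H \<Longrightarrow> x \<in> H \<Longrightarrow> conjugate G g x \<in> H"
  by (simp add: conjugate_def subgroup.m_closed subgroup.m_inv_closed)

lemma conjugate_image_subgroup:
  assumes H: "subgroup H G" and g: "g \<in> H"
  shows "conjugate G g ` H = H"
proof
  show "conjugate G g ` H \<subseteq> H"
    using conjugate_in_subgroup[OF H g] by blast
  show "H \<subseteq> conjugate G g ` H"
  proof
    fix x assume x: "x \<in> H"
    have "conjugate G (inv g) x \<in> H"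
      using conjugate_in_subgroup[OF H subgroup.m_inv_closed[OF H g] x] .
    moreover have "x = conjugate G g (conjugate G (inv g) x)"
      using x g by (simp add: subgroup.mem_carrier[OF H])
    ultimately show "x \<in> conjugate G g ` H" by blast
  qed
qed

lemma normal_iff_conjugate:
  "N \<lhd> G \<longleftrightarrow> subgroup N G \<and> (\<forall>g\<in>carrier G. \<forall>x\<in>N. conjugate G g x \<in> N)"
proof
  assume "N \<lhd> G"
  then show "subgroup N G \<and> (\<forall>g\<in>carrier G. \<forall>x\<in>N. conjugate G g x \<in> N)"
    by (simp add: conjugate_def normal_imp_subgroup normal.inv_op_closed1)
next
  assume N: "subgroup N G \<and> (\<forall>g\<in>carrier G. \<forall>x\<in>N. conjugate G g x \<in> N)"
  show "N \<lhd> G"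
    unfolding normal_inv_iff
  proof (intro conjI ballI)
    fix g x assume "g \<in> carrier G" "x \<in> N"
    then have "conjugate G (inv g) x \<in> N" using N by simp
    then show "g \<otimes> x \<otimes> inv g \<in> N" using \<open>g \<in> carrier G\<close> by (simp add: conjugate_def)
  qed (use N in simp)
qed

lemma normal_conjugate: "N \<lhd> G \<Longrightarrow> g \<in> carrier G \<Longrightarrow> x \<in> N \<Longrightarrow> conjugate G g x \<in> N"
  by (simp add: normal_iff_conjugate)

section \<open>Normalizers and centralizers described by conjugation\<close>

lemma normalizer_ofI:
  assumes "finite Q" "Q \<subseteq> carrier G" "g \<in> carrier G" "conjugate G g ` Q \<subseteq> Q"
  shows "g \<in> normalizer_of G Q"
  using assms unfolding normalizer_of_def by (simp add: card_conjugate card_subset_eq)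

lemma normalizer_of_subgroup: 
  assumes Q: "Q \<subseteq> carrier G"
  shows "subgroup (normalizer_of G Q) G"
proof (rule subgroupI)
  show "normalizer_of G Q \<noteq> {}"
    using Q by (metis (mono_tags, lifting) conjugate_image_one empty_iff mem_Collect_eq normalizer_of_def one_closed)
next
  fix g assume g: "g \<in> normalizer_of G Q"
  then have "conjugate G (inv g) ` Q = conjugate G (inv g) ` conjugate G g ` Q"
    by (simp add: normalizer_of_def)
  also have "\<dots> = Q"
    using g Q conjugate_image_mult[of g "inv g" Q] by (simp add: normalizer_of_def)
  finally show "inv g \<in> normalizer_of G Q"
    using g by (simp add: normalizer_of_def)
next
  fix g h assume "g \<in> normalizer_of G Q" "h \<in> normalizer_of G Q"
  then show "g \<otimes> h \<in> normalizer_of G Q"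
    using Q by (simp add: normalizer_of_def conjugate_image_mult)
qed (auto simp: normalizer_of_def)

text \<open>If \<open>y\<close> is the conjugate of \<open>n\<close> by \<open>a\<close>, then
  \<open>a \<otimes> y = n \<otimes> a\<close>. Applied to the inverse of \<open>a\<close> as well,
  the inclusion shows that conjugate subgroups have normalizers of the same order.\<close>

lemma conjugate_normalizer_of:
  assumes a: "a \<in> carrier G" and B: "B \<subseteq> carrier G"
  shows "conjugate G a ` normalizer_of G B \<subseteq> normalizer_of G (conjugate G a ` B)"
proof
  fix y assume "y \<in> conjugate G a ` normalizer_of G B"
  then obtain n where n: "n \<in> carrier G" "conjugate G n ` B = B" "y = conjugate G a n"
    by (auto simp: normalizer_of_def)
  have "conjugate G y ` conjugate G a ` B = conjugate G (a \<otimes> y) ` B"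
    using n a B by (simp add: conjugate_image_mult)
  also have "a \<otimes> y = n \<otimes> a"
    using n(1,3) a by (simp add: conjugate_def flip: m_assoc)
  also have "conjugate G (n \<otimes> a) ` B = conjugate G a ` B"
    using n a B by (simp add: conjugate_image_mult)
  finally show "y \<in> normalizer_of G (conjugate G a ` B)"
    using n a by (simp add: normalizer_of_def)
qed

lemma subgroup_le_normalizer_of: "subgroup Q G \<Longrightarrow> Q \<subseteq> normalizer_of G Q"
  by (rule subsetI) (simp add: normalizer_of_def conjugate_image_subgroup subgroup.mem_carrier)

lemma normal_in_normalizer_of:
  assumes Q: "subgroup Q G"
  shows "Q \<lhd> subgrp G (normalizer_of G Q)"
proof -
  have N: "subgroup (normalizer_of G Q) G"
    using Q by (simp add: normalizer_of_subgroup subgroup.subset)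
  interpret N: group "subgrp G (normalizer_of G Q)"
    by (rule subgroup_imp_group[OF N])
  show ?thesis
    unfolding N.normal_iff_conjugate
    using subgroup_incl[OF Q N subgroup_le_normalizer_of[OF Q]] conjugate_subgrp[OF N]
    by (auto simp: normalizer_of_def)
qed

lemma centralizer_of_subgroup:
  assumes Q: "Q \<subseteq> carrier G"
  shows "subgroup (centralizer_of G Q) G"
proof (rule subgroupI)
  have "\<one> \<in> centralizer_of G Q"
    using Q by (simp add: centralizer_of_def subset_iff)
  then show "centralizer_of G Q \<noteq> {}" by blast
next
  fix g assume g: "g \<in> centralizer_of G Q"
  have "conjugate G (inv g) x = x" if "x \<in> Q" for x
    using g that conjugate_inv_cancel(1)[OF _ subsetD[OF Q that], of g] by (auto simp: centralizer_of_def)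
  then show "inv g \<in> centralizer_of G Q"
    using g by (simp add: centralizer_of_def)
next
  fix g h assume "g \<in> centralizer_of G Q" "h \<in> centralizer_of G Q"
  then show "g \<otimes> h \<in> centralizer_of G Q"
    using Q by (simp add: centralizer_of_def conjugate_conjugate subset_iff)
qed (auto simp: centralizer_of_def)

lemma centralizer_of_normal:
  assumes Q: "Q \<lhd> G"
  shows "centralizer_of G Q \<lhd> G"
  unfolding normal_iff_conjugate
proof (intro conjI ballI)
  have sub: "Q \<subseteq> carrier G"
    using Q by (simp add: normal_imp_subgroup subgroup.subset)
  then show "subgroup (centralizer_of G Q) G" by (rule centralizer_of_subgroup)
  fix g c assume g: "g \<in> carrier G" and c: "c \<in> centralizer_of G Q"
  have "conjugate G (conjugate G g c) x = x" if x: "x \<in> Q" for x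
  proof -
    have "conjugate G c (conjugate G (inv g) x) = conjugate G (inv g) x"
      using c normal_conjugate[OF Q _ x, of "inv g"] g by (simp add: centralizer_of_def)
    then have "conjugate G g (conjugate G c (conjugate G (inv g) x)) = x"
      using g x sub by auto
    moreover have "conjugate G (conjugate G g c) x = conjugate G (inv g \<otimes> c \<otimes> g) x"
      by (simp add: conjugate_def)
    ultimately show ?thesis
      using g c x sub by (simp add: conjugate_conjugate centralizer_of_def subset_iff)
  qed
  then show "conjugate G g c \<in> centralizer_of G Q"
    using g c by (simp add: centralizer_of_def)
qed

end

section \<open>Sylow subgroups\<close>

text \<open>Bijectivity need not be assumed: the inverse of \<open>\<phi> g\<close> is
  \<open>\<phi>\<close> at the inverse of \<open>g\<close>. The restriction to \<open>E\<close> is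
  there because elements of \<open>BijGroup E\<close> are extensional.\<close>

lemma group_actionI:
  fixes G (structure)
  assumes "group G"
    and closed: "\<And>g x. g \<in> carrier G \<Longrightarrow> x \<in> E \<Longrightarrow> \<phi> g x \<in> E"
    and one: "\<And>x. x \<in> E \<Longrightarrow> \<phi> \<one>\<^bsub>G\<^esub> x = x"
    and mult: "\<And>g h x. g \<in> carrier G \<Longrightarrow> h \<in> carrier G \<Longrightarrow> x \<in> E \<Longrightarrow>
      \<phi> (g \<otimes>\<^bsub>G\<^esub> h) x = \<phi> g (\<phi> h x)"
  shows "group_action G E (\<lambda>g. restrict (\<phi> g) E)"
proof -
  interpret group G by fact
  have inv: "\<phi> (inv g) (\<phi> g x) = x" "\<phi> g (\<phi> (inv g) x) = x"
    if "g \<in> carrier G" "x \<in> E" for g x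
    using that by (simp_all add: one flip: mult)
  have bij: "bij_betw (restrict (\<phi> g) E) E E" if "g \<in> carrier G" for g
    by (rule bij_betwI[where g = "\<phi> (inv g)"]) (use that in \<open>auto simp: closed inv\<close>)
  show ?thesis
    unfolding group_action_def group_hom_def group_hom_axioms_def
  proof (intro conjI is_group group_BijGroup homI)
    have Bij: "restrict (\<phi> g) E \<in> Bij E" if "g \<in> carrier G" for g
      using bij[OF that] by (simp add: Bij_def)
    then show "restrict (\<phi> g) E \<in> carrier (BijGroup E)" if "g \<in> carrier G" for g
      using that by (simp add: BijGroup_def)
    fix g h assume gh: "g \<in> carrier G" "h \<in> carrier G"
    have "restrict (\<phi> (g \<otimes> h)) E = compose E (restrict (\<phi> g) E) (restrict (\<phi> h) E)"
      by (rule ext) (use gh in \<open>simp add: compose_def mult closed\<close>)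
    then show "restrict (\<phi> (g \<otimes> h)) E = restrict (\<phi> g) E \<otimes>\<^bsub>BijGroup E\<^esub> restrict (\<phi> h) E"
      using gh by (simp add: BijGroup_def Bij)
  qed
qed

text \<open>Orbit sizes divide a power of p. An orbit with more than one point has size divisible by
  p and contains no fixed point, so modulo p only the one-point orbits count.\<close>

lemma (in group_action) card_fixed_points_cong:
  assumes p: "Factorial_Ring.prime p" and G: "order G = p ^ k" and fin: "finite E"
  shows "[card E = card {x \<in> E. \<forall>g\<in>carrier G. \<phi> g x = x}] (mod p)"
proof -
  let ?F = "{x \<in> E. \<forall>g\<in>carrier G. \<phi> g x = x}"
  let ?O = "orbits G E \<phi>"
  have finO: "finite ?O" and finorb: "\<And>A. A \<in> ?O \<Longrightarrow> finite A"
    using finite_UnionD[of ?O] fin by (simp_all add: orbits_coverture)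
      (metis Sup_upper fin finite_subset orbits_coverture)
  have orb: "[card A = card (A \<inter> ?F)] (mod p)" if A: "A \<in> ?O" for A
  proof -
    obtain x where x: "x \<in> E" "A = orbit G \<phi> x"
      using A unfolding orbits_def by blast
    have "card A * card (stabilizer G \<phi> x) = p ^ k"
      using orbit_stabilizer_theorem[OF x(1)] x(2) G by simp
    then have "card A dvd p ^ k" by (metis dvd_triv_left)
    then obtain i where i: "card A = p ^ i"
      using divides_primepow_nat[OF p] by blast
    show ?thesis
    proof (cases "i = 0")
      case True
      then have "A = {x}"
        using i orbit_refl[OF x(1)] x(2) by (auto simp: card_1_singleton_iff)
      moreover have "x \<in> ?F"
        using x \<open>A = {x}\<close> by (auto simp: orbit_def)
      ultimately show ?thesis by (simp add: Int_absorb2)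
    next
      case False
      have "A \<inter> ?F = {}"
      proof (rule ccontr)
        assume "A \<inter> ?F \<noteq> {}"
        then obtain y where y: "y \<in> A" "y \<in> ?F" by blast
        then have "x \<in> orbit G \<phi> y" using orbit_sym x by auto
        then have "x = y" using y(2) by (auto simp: orbit_def)
        then have "A = {x}" using x y(2) orbit_refl[OF x(1)] by (auto simp: orbit_def)
        then have "p ^ i = 1" using i by simp
        then show False using False p prime_gt_1_nat by fastforce
      qed
      then show ?thesis
        using i False by (simp add: cong_0_iff)
    qed
  qed
  have sum: "(\<Sum>A\<in>?O. \<Sum>x\<in>A. f x) = (\<Sum>x\<in>E. f x)" for f :: "'c \<Rightarrow> nat"
    by (rule disjoint_sum[OF fin])
  have "card E = (\<Sum>A\<in>?O. card A)"
    using sum[of "\<lambda>_. 1"] by simp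
  moreover have "card ?F = (\<Sum>A\<in>?O. card (A \<inter> ?F))"
    using sum[of "\<lambda>x. if x \<in> ?F then 1 else 0"] fin finorb
    by (simp add: sum.If_cases Int_def conj_ac)
  ultimately show ?thesis
    using cong_sum[of ?O card "\<lambda>A. card (A \<inter> ?F)" p] orb by simp
qed

section \<open>Conjugacy of Sylow subgroups and growth of normalizers, by counting fixed
  cosets\<close>

context group
begin

lemma card_fixed_rcosets_cong:
  assumes fin: "finite (carrier G)" and p: "Factorial_Ring.prime p"
    and P: "subgroup P G" "card P = p ^ k" and H: "subgroup H G"
  shows "[card (rcosets H) =
    card {C. \<exists>x\<in>carrier G. C = H #> x \<and> (\<forall>g\<in>P. x \<otimes> g \<otimes> inv x \<in> H)}] (mod p)"
proof -
  interpret H: subgroup H G by fact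
  interpret P: group "subgrp G P" by (rule subgroup_imp_group[OF P(1)])
  note Pc = subgroup.mem_carrier[OF P(1)]
  \<comment> \<open>The inverse turns right multiplication of cosets into a left action. The coset
    of \<open>x\<close> is fixed by \<open>P\<close> exactly if x P x^-1 lies in
    \<open>H\<close>.\<close>
  let ?\<phi> = "\<lambda>g C. C #> inv g"
  have act: "group_action (subgrp G P) (rcosets H) (\<lambda>g. restrict (?\<phi> g) (rcosets H))"
  proof (rule group_actionI)
    fix g C assume "g \<in> carrier (subgrp G P)" and C: "C \<in> rcosets H"
    then have g: "g \<in> carrier G" by (simp add: Pc)
    from C g show "C #> inv g \<in> rcosets H"
      by (auto simp: RCOSETS_def coset_mult_assoc H.subset intro!: bexI[of _ "_ \<otimes> inv g"])
  next
    fix C assume "C \<in> rcosets H"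
    then have "C \<subseteq> carrier G" by (simp add: H.rcosets_carrier)
    then show "C #> inv \<one>\<^bsub>subgrp G P\<^esub> = C" by simp
  next
    fix g h C
    assume "g \<in> carrier (subgrp G P)" "h \<in> carrier (subgrp G P)" and C: "C \<in> rcosets H"
    then have "g \<in> carrier G" "h \<in> carrier G" "C \<subseteq> carrier G"
      by (simp_all add: Pc H.rcosets_carrier)
    then show "C #> inv (g \<otimes>\<^bsub>subgrp G P\<^esub> h) = (C #> inv h) #> inv g"
      by (simp add: inv_mult_group coset_mult_assoc)
  qed (rule P.is_group)
  have eq: "(H #> x) #> inv g = H #> x \<longleftrightarrow> x \<otimes> g \<otimes> inv x \<in> H"
    if x: "x \<in> carrier G" and g: "g \<in> carrier G" for x g
  proof -
    have "(H #> x) #> inv g = H #> x \<longleftrightarrow> H #> (x \<otimes> inv g) = H #> x"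
      using x g by (simp add: coset_mult_assoc H.subset)
    also have "\<dots> \<longleftrightarrow> x \<in> H #> (x \<otimes> inv g)"
      using x g by (metis H.is_subgroup inv_closed m_closed rcos_self repr_independence)
    also have "\<dots> \<longleftrightarrow> x \<otimes> inv (x \<otimes> inv g) \<in> H"
      using x g by (metis H.rcos_module is_group inv_closed m_closed)
    also have "x \<otimes> inv (x \<otimes> inv g) = x \<otimes> g \<otimes> inv x"
      using x g by (simp add: inv_mult_group m_assoc)
    finally show ?thesis .
  qed
  have "{C. \<exists>x\<in>carrier G. C = H #> x \<and> (\<forall>g\<in>P. x \<otimes> g \<otimes> inv x \<in> H)} =
    {C \<in> rcosets H. \<forall>g\<in>carrier (subgrp G P). restrict (?\<phi> g) (rcosets H) C = C}"
  proof (intro equalityI subsetI)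
    fix C assume "C \<in> {C. \<exists>x\<in>carrier G. C = H #> x \<and> (\<forall>g\<in>P. x \<otimes> g \<otimes> inv x \<in> H)}"
    then obtain x where x: "x \<in> carrier G" "C = H #> x" "\<forall>g\<in>P. x \<otimes> g \<otimes> inv x \<in> H"
      by blast
    then have "\<forall>g\<in>P. C #> inv g = C"
      using eq Pc by simp
    moreover have "C \<in> rcosets H"
      using x by (simp add: rcosetsI H.subset)
    ultimately show
      "C \<in> {C \<in> rcosets H. \<forall>g\<in>carrier (subgrp G P). restrict (?\<phi> g) (rcosets H) C = C}"
      by simp
  next
    fix C
    assume "C \<in> {C \<in> rcosets H. \<forall>g\<in>carrier (subgrp G P). restrict (?\<phi> g) (rcosets H) C = C}"
    then have C: "C \<in> rcosets H" "\<forall>g\<in>P. C #> inv g = C" by auto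
    then obtain x where x: "x \<in> carrier G" "C = H #> x"
      by (auto simp: RCOSETS_def)
    moreover have "\<forall>g\<in>P. x \<otimes> g \<otimes> inv x \<in> H"
      using C x eq Pc by simp
    ultimately show "C \<in> {C. \<exists>x\<in>carrier G. C = H #> x \<and> (\<forall>g\<in>P. x \<otimes> g \<otimes> inv x \<in> H)}"
      by blast
  qed
  moreover have "finite (rcosets H)"
    using fin by (simp add: RCOSETS_def)
  ultimately show ?thesis
    using group_action.card_fixed_points_cong[OF act p, of k] P(2) by (simp add: order_def)
qed

lemma not_dvd_card_rcosets_sylow:
  assumes fin: "finite (carrier G)" and p: "Factorial_Ring.prime p" and S: "sylow_subgroup p G S"
  shows "\<not> p dvd card (rcosets S)"
proof
  assume "p dvd card (rcosets S)"
  then have "p ^ Suc (multiplicity p (order G)) dvd order G"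
    using lagrange_finite[OF fin, of S] S
    by (metis dvd_refl mult_dvd_mono power_Suc sylow_subgroup_def)
  moreover have "order G \<noteq> 0" using fin order_gt_0_iff_finite by simp
  moreover have "\<not> is_unit p" using p not_prime_unit by blast
  ultimately have "Suc (multiplicity p (order G)) \<le> multiplicity p (order G)"
    using power_dvd_iff_le_multiplicity by blast
  then show False by simp
qed

text \<open>Let \<open>P\<close> act on the cosets of \<open>S\<close>. Their number is prime to p,
  so some coset is fixed, and a representative of it conjugates \<open>P\<close> into
  \<open>S\<close>.\<close>

theorem sylow_conjugate:
  assumes fin: "finite (carrier G)" and p: "Factorial_Ring.prime p" and S: "sylow_subgroup p G S"
    and P: "p_subgroup p G P"
  shows "\<exists>g\<in>carrier G. conjugate G g ` P \<subseteq> S"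
proof -
  obtain k where k: "subgroup P G" "card P = p ^ k"
    using P by (auto simp: p_subgroup_def)
  let ?F = "{C. \<exists>x\<in>carrier G. C = S #> x \<and> (\<forall>g\<in>P. x \<otimes> g \<otimes> inv x \<in> S)}"
  have "[card (rcosets S) = card ?F] (mod p)"
    using card_fixed_rcosets_cong[OF fin p k] S by (simp add: sylow_subgroup_def)
  then have "card ?F \<noteq> 0"
    using not_dvd_card_rcosets_sylow[OF fin p S] cong_dvd_iff[of "card (rcosets S)" "card ?F" p]
    by (intro notI) simp
  then have "?F \<noteq> {}" by (intro notI) (simp only: card.empty)
  then obtain x where "x \<in> carrier G" "\<forall>g\<in>P. x \<otimes> g \<otimes> inv x \<in> S"
    by blast
  then show ?thesis
    \<comment> \<open>A fixed coset gives x P x^-1 inside \<open>S\<close>, which in the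
      right-action convention is conjugation by the inverse of \<open>x\<close>.\<close>
    by (intro bexI[of _ "inv x"]) (auto simp: conjugate_def)
qed

lemma sylow_superset:
  assumes fin: "finite (carrier G)" and p: "Factorial_Ring.prime p"
    and P: "p_subgroup p G P"
  shows "\<exists>S. sylow_subgroup p G S \<and> P \<subseteq> S"
proof -
  have "order G \<noteq> 0" using fin order_gt_0_iff_finite by simp
  then obtain m where "order G = p ^ multiplicity p (order G) * m"
    using multiplicity_dvd by blast
  then obtain S where S: "sylow_subgroup p G S"
    using sylow_thm[OF p is_group _ fin] by (auto simp: sylow_subgroup_def)
  obtain g where g: "g \<in> carrier G" "conjugate G g ` P \<subseteq> S"
    using sylow_conjugate[OF fin p S P] by blast
  have "sylow_subgroup p G (conjugate G (inv g) ` S)"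
    using S g(1) by (simp add: sylow_subgroup_def subgroup_conjugate card_conjugate subgroup.subset)
  moreover have "P \<subseteq> conjugate G (inv g) ` S"
  proof
    fix x assume "x \<in> P"
    moreover from this have "x \<in> carrier G"
      using P by (auto simp: p_subgroup_def dest: subgroup.mem_carrier)
    ultimately show "x \<in> conjugate G (inv g) ` S"
      using g by (metis conjugate_inv_cancel(1) image_eqI image_subset_iff)
  qed
  ultimately show ?thesis by blast
qed

text \<open>Let \<open>Q\<close> act on its own cosets. The number of fixed cosets is divisible by
  p, and \<open>Q\<close> is one of them; a second fixed coset supplies an element outside
  \<open>Q\<close> that normalizes \<open>Q\<close>.\<close>

lemma p_group_normalizer_grows:
  assumes fin: "finite (carrier G)" and p: "Factorial_Ring.prime p" and G: "order G = p ^ n"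
    and Q: "subgroup Q G" "Q \<noteq> carrier G"
  shows "\<exists>x\<in>carrier G - Q. conjugate G x ` Q \<subseteq> Q"
proof -
  interpret Q: subgroup Q G by fact
  let ?F = "{C. \<exists>x\<in>carrier G. C = Q #> x \<and> (\<forall>g\<in>Q. x \<otimes> g \<otimes> inv x \<in> Q)}"
  have lag: "card (rcosets Q) * card Q = p ^ n"
    using lagrange_finite[OF fin Q(1)] G by simp
  have "card Q dvd p ^ n" by (metis lag dvd_triv_right)
  then obtain k where k: "card Q = p ^ k"
    using divides_primepow_nat[OF p] by blast
  have "card (rcosets Q) \<noteq> 1"
    using lag G Q by (metis Q.subset card_subset_eq fin mult_1 order_def)
  moreover have "card (rcosets Q) dvd p ^ n" by (metis lag dvd_triv_left)
  ultimately have "p dvd card (rcosets Q)"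
    using divides_primepow_nat[OF p] by (metis dvd_refl dvd_power power_0 zero_less_iff_neq_zero)
  then have "p dvd card ?F"
    using card_fixed_rcosets_cong[OF fin p Q(1) k Q(1)] cong_dvd_iff by blast
  moreover have mem: "Q \<in> ?F"
    using Q.subset by (auto intro!: bexI[of _ \<one>] simp: subset_iff)
  moreover have "finite ?F"
    using fin by (auto intro: finite_subset[of _ "(\<lambda>x. Q #> x) ` carrier G"])
  ultimately have "?F \<noteq> {Q}"
    using p by (metis One_nat_def card.empty card.insert empty_iff finite.emptyI not_prime_unit
        nat_dvd_1_iff_1)
  then obtain x where x: "x \<in> carrier G" "Q #> x \<noteq> Q" "\<forall>g\<in>Q. x \<otimes> g \<otimes> inv x \<in> Q"
    using mem by blast
  have "x \<notin> Q"
    using x(1,2) coset_join2[OF x(1) Q(1)] by blast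
  then have "inv x \<notin> Q"
    using x(1) Q.m_inv_closed by fastforce
  then show ?thesis
    using x by (intro bexI[of _ "inv x"]) (auto simp: conjugate_def)
qed

end

section \<open>Chief factors and the supersolvable hypercenter\<close>

text \<open>Cyclicity of H/K expressed by elements. It can then be compared between different pairs
  of subgroups without constructing isomorphisms of quotients.\<close>

definition cyclic_mod :: "('a, 'b) monoid_scheme \<Rightarrow> 'a set \<Rightarrow> 'a set \<Rightarrow> bool" where
  "cyclic_mod G H K \<longleftrightarrow>
     (\<exists>h\<in>H. \<forall>x\<in>H. \<exists>(i::int). \<exists>k\<in>K. x = k \<otimes>\<^bsub>G\<^esub> h [^]\<^bsub>G\<^esub> i)"

text \<open>The property whose greatest instance is the supersolvable hypercenter.\<close>

definition hypercentral :: "('a, 'b) monoid_scheme \<Rightarrow> 'a set \<Rightarrow> bool" where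
  "hypercentral G N \<longleftrightarrow>
     N \<lhd> G \<and> (\<forall>H K. chief_factor G H K \<and> H \<subseteq> N \<longrightarrow> cyclic_mod G H K)"

context group
begin

lemma rcos_eq_iff:
  assumes K: "subgroup K G" and xy: "x \<in> carrier G" "y \<in> carrier G"
  shows "K #> x = K #> y \<longleftrightarrow> (\<exists>k\<in>K. x = k \<otimes> y)"
proof -
  have "K #> x = K #> y \<longleftrightarrow> x \<in> K #> y"
    using repr_independence[of x K y] rcos_self[of x K] xy K by auto
  then show ?thesis by (auto simp: r_coset_def)
qed

lemma cyclic_group_Mod_iff:
  assumes H: "subgroup H G" and K: "K \<lhd> subgrp G H"
  shows "cyclic_group (subgrp G H Mod K) \<longleftrightarrow> cyclic_mod G H K"
proof -
  interpret H: group "subgrp G H" by (rule subgroup_imp_group[OF H])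
  interpret K: normal K "subgrp G H" by (rule K)
  interpret M: group "subgrp G H Mod K" by (rule K.factorgroup_is_group)
  have coset: "K #> x = K #> y \<longleftrightarrow> (\<exists>k\<in>K. x = k \<otimes> y)" if "x \<in> H" "y \<in> H" for x y
    using H.rcos_eq_iff[OF K.is_subgroup, of x y] that by simp
  have pow: "h [^]\<^bsub>subgrp G H\<^esub> i = h [^] i" if "h \<in> H" for h and i :: int
    using int_pow_consistent[OF H that] by simp
  have closed: "h [^] i \<in> H" if "h \<in> H" for h and i :: int
    using subgroup_int_pow_closed[OF H that] .
  have "cyclic_group (subgrp G H Mod K) \<longleftrightarrow>
      (\<exists>h\<in>H. (\<lambda>x. K #> x) ` H = range (\<lambda>i::int. (K #> h) [^]\<^bsub>subgrp G H Mod K\<^esub> i))"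
    unfolding M.cyclic_group by (simp add: carrier_FactGroup)
  also have "\<dots> \<longleftrightarrow> (\<exists>h\<in>H. (\<lambda>x. K #> x) ` H = range (\<lambda>i::int. K #> h [^] i))"
    using K.FactGroup_int_pow by (simp add: pow)
  also have "\<dots> \<longleftrightarrow> (\<exists>h\<in>H. \<forall>x\<in>H. \<exists>i::int. K #> x = K #> h [^] i)"
  proof (intro bex_cong refl)
    fix h assume "h \<in> H"
    then have "range (\<lambda>i::int. K #> h [^] i) \<subseteq> (\<lambda>x. K #> x) ` H"
      using closed by (intro image_subsetI imageI)
    then have "((\<lambda>x. K #> x) ` H = range (\<lambda>i::int. K #> h [^] i)) \<longleftrightarrow>
        (\<lambda>x. K #> x) ` H \<subseteq> range (\<lambda>i::int. K #> h [^] i)"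
      by (simp add: set_eq_subset)
    also have "\<dots> \<longleftrightarrow> (\<forall>x\<in>H. \<exists>i::int. K #> x = K #> h [^] i)"
      by (simp add: image_subset_iff image_iff)
    finally show "((\<lambda>x. K #> x) ` H = range (\<lambda>i::int. K #> h [^] i)) \<longleftrightarrow>
        (\<forall>x\<in>H. \<exists>i::int. K #> x = K #> h [^] i)" .
  qed
  also have "\<dots> \<longleftrightarrow> cyclic_mod G H K"
    unfolding cyclic_mod_def by (simp add: coset closed)
  finally show ?thesis .
qed

lemma card_subgroup_dvd:
  assumes fin: "finite (carrier G)" and A: "subgroup A G" and B: "subgroup B G" and AB: "A \<subseteq> B"
  shows "card A dvd card B"
proof -
  interpret B: group "subgrp G B" by (rule subgroup_imp_group[OF B])
  have "card (rcosets\<^bsub>subgrp G B\<^esub> A) * card A = card B"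
    using B.lagrange_finite[OF _ subgroup_incl[OF A B AB]] finite_subset[OF subgroup.subset[OF B] fin]
    by (simp add: order_def)
  then show ?thesis by (metis dvd_triv_right)
qed

section \<open>Chief factors compared with a second normal subgroup\<close>

lemma mem_set_mult_iff: "x \<in> A <#> B \<longleftrightarrow> (\<exists>a\<in>A. \<exists>b\<in>B. x = a \<otimes> b)"
  by (auto simp: set_mult_def)

lemma set_multI: "x \<in> A \<Longrightarrow> y \<in> B \<Longrightarrow> x \<otimes> y \<in> A <#> B"
  by (auto simp: set_mult_def)

lemma normal_set_mult_subsets:
  assumes "M \<lhd> G" "N \<lhd> G"
  shows "M \<subseteq> M <#> N" "N \<subseteq> M <#> N"
proof -
  note s = normal_imp_subgroup[OF assms(1)] normal_imp_subgroup[OF assms(2)]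
  show "M \<subseteq> M <#> N"
    using set_multI[of _ M \<one> N] s by (auto simp: subgroup.one_closed subgroup.mem_carrier)
  show "N \<subseteq> M <#> N"
    using set_multI[of \<one> M _ N] s by (auto simp: subgroup.one_closed subgroup.mem_carrier)
qed

lemma set_mult_subset_subgroup:
  "subgroup L G \<Longrightarrow> M \<subseteq> L \<Longrightarrow> N \<subseteq> L \<Longrightarrow> M <#> N \<subseteq> L"
  by (auto simp: set_mult_def subset_iff subgroup.m_closed)

lemma chief_factorD:
  assumes "chief_factor G H K"
  shows "H \<lhd> G" "K \<lhd> G" "K \<subset> H"
    "\<And>L. L \<lhd> G \<Longrightarrow> K \<subseteq> L \<Longrightarrow> L \<subseteq> H \<Longrightarrow> L = K \<or> L = H"
  using assms by (auto simp: chief_factor_def)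

text \<open>For a normal \<open>L\<close> inside \<open>H\<close> the product \<open>K <#> L\<close>
  lies between \<open>K\<close> and \<open>H\<close>, so it equals one of them. With
  \<open>L = H \<inter> N\<close> this leaves only \<open>H\<close>, and H/K is then isomorphic to
  the factor of the intersections with \<open>N\<close>.\<close>

lemma chief_factor_Int:
  assumes ch: "chief_factor G H K" and N: "N \<lhd> G" and nle: "\<not> H \<inter> N \<subseteq> K"
  shows "H = K <#> (H \<inter> N)" "chief_factor G (H \<inter> N) (K \<inter> N)"
proof -
  note ch = chief_factorD[OF ch]
  have HN: "H \<inter> N \<lhd> G" and KN: "K \<inter> N \<lhd> G"
    using ch N by (simp_all add: normal_subgroup_intersect)
  note sub = normal_imp_subgroup[OF ch(1)] normal_imp_subgroup[OF ch(2)] normal_imp_subgroup[OF N]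
  have mid: "K <#> L = K \<or> K <#> L = H" if "L \<lhd> G" "L \<subseteq> H" for L
  proof (rule ch(4))
    show "K <#> L \<lhd> G" using ch(2) that(1) by (rule normal_subgroup_set_mult_closed)
    show "K \<subseteq> K <#> L" using ch(2) that(1) by (rule normal_set_mult_subsets)
    show "K <#> L \<subseteq> H"
      using ch(3) that(2) by (intro set_mult_subset_subgroup sub(1)) auto
  qed
  show H: "H = K <#> (H \<inter> N)"
    using mid[OF HN] normal_set_mult_subsets(2)[OF ch(2) HN] nle by auto
  show "chief_factor G (H \<inter> N) (K \<inter> N)"
    unfolding chief_factor_def
  proof (intro conjI HN KN notI)
    show "K \<inter> N \<subset> H \<inter> N" using ch(3) nle by blast
    assume "\<exists>L. L \<lhd> G \<and> K \<inter> N \<subset> L \<and> L \<subset> H \<inter> N"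
    then obtain L where L: "L \<lhd> G" "K \<inter> N \<subset> L" "L \<subset> H \<inter> N" by blast
    note Ls = normal_imp_subgroup[OF L(1)]
    have "K <#> L \<noteq> K"
      using L normal_set_mult_subsets(2)[OF ch(2) L(1)] by blast
    then have KL: "K <#> L = H" using mid[of L] L by blast
    have "x \<in> L" if x: "x \<in> H \<inter> N" for x
    proof -
      obtain k l where kl: "k \<in> K" "l \<in> L" "x = k \<otimes> l"
        using x KL by (auto simp: set_mult_def)
      have "k = x \<otimes> inv l"
        using kl by (simp add: subgroup.mem_carrier[OF sub(2)] subgroup.mem_carrier[OF Ls] m_assoc)
      moreover have "l \<in> N" using kl L by blast
      ultimately have "k \<in> N"
        using x sub(3) by (simp add: subgroup.m_closed subgroup.m_inv_closed)
      then have "k \<in> L" using kl L by blast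
      then show ?thesis using kl subgroup.m_closed[OF Ls] by simp
    qed
    then show False using L by blast
  qed
qed

text \<open>Dedekind's law: as \<open>K\<close> lies in \<open>H\<close>, the intersection of
  \<open>H\<close> with \<open>K <#> N\<close> is \<open>K <#> (H \<inter> N)\<close>.\<close>

lemma Int_set_mult_le:
  assumes H: "H \<lhd> G" and K: "K \<lhd> G" and N: "N \<lhd> G" and KH: "K \<subseteq> H" and le: "H \<inter> N \<subseteq> L"
    and KL: "K \<subseteq> L" and L: "subgroup L G"
    and x: "x \<in> H" "x \<in> K <#> N"
  shows "x \<in> L"
proof -
  note sub = normal_imp_subgroup[OF H] normal_imp_subgroup[OF K] normal_imp_subgroup[OF N]
  obtain k n where kn: "k \<in> K" "n \<in> N" "x = k \<otimes> n"
    using x by (auto simp: set_mult_def)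
  have "n = inv k \<otimes> x"
    using kn by (simp add: subgroup.mem_carrier[OF sub(2)] subgroup.mem_carrier[OF sub(3)]
        flip: m_assoc)
  moreover have "k \<in> H" using kn KH by blast
  ultimately have "n \<in> H"
    using x sub(1) by (simp add: subgroup.m_closed subgroup.m_inv_closed)
  then show ?thesis
    using kn le KL subgroup.m_closed[OF L, of k n] by auto
qed

text \<open>The case complementary to \<open>chief_factor_Int\<close>: \<open>N\<close> contributes
  nothing between \<open>K\<close> and \<open>H\<close>, so multiplying by \<open>N\<close> keeps
  the factor up to isomorphism.\<close>

lemma chief_factor_set_mult:
  assumes ch: "chief_factor G H K" and N: "N \<lhd> G" and le: "H \<inter> N \<subseteq> K"
  shows "chief_factor G (H <#> N) (K <#> N)"
proof -
  note ch = chief_factorD[OF ch]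
  have HN: "H <#> N \<lhd> G" and KN: "K <#> N \<lhd> G"
    using ch N by (simp_all add: normal_subgroup_set_mult_closed)
  note sub = normal_imp_subgroup[OF ch(1)] normal_imp_subgroup[OF ch(2)] normal_imp_subgroup[OF N]
  note sm = normal_set_mult_subsets
  show ?thesis
    unfolding chief_factor_def
  proof (intro conjI HN KN notI)
    have "\<not> H \<subseteq> K <#> N"
      using Int_set_mult_le[OF ch(1,2) N _ le _ sub(2)] ch(3) by blast
    then show "K <#> N \<subset> H <#> N"
      using ch(3) mono_set_mult[of K H N N G] sm(1)[OF ch(1) N] by blast
    assume "\<exists>L. L \<lhd> G \<and> K <#> N \<subset> L \<and> L \<subset> H <#> N"
    then obtain L where L: "L \<lhd> G" "K <#> N \<subset> L" "L \<subset> H <#> N" by blast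
    have KL: "K \<subseteq> L" and NL: "N \<subseteq> L" using sm[OF ch(2) N] L by blast+
    have "L \<inter> H = K \<or> L \<inter> H = H"
      by (rule ch(4)) (use L ch KL in \<open>auto intro: normal_subgroup_intersect\<close>)
    then show False
    proof
      assume LH: "L \<inter> H = H"
      then have "H <#> N \<subseteq> L"
        using NL by (intro set_mult_subset_subgroup normal_imp_subgroup L) auto
      then show False using L by blast
    next
      assume LH: "L \<inter> H = K"
      have "x \<in> K <#> N" if x: "x \<in> L" for x
      proof -
        obtain h n where hn: "h \<in> H" "n \<in> N" "x = h \<otimes> n"
          using x L mem_set_mult_iff[of x H N] by auto
        have "h = x \<otimes> inv n"
          using hn by (simp add: subgroup.mem_carrier[OF sub(1)] subgroup.mem_carrier[OF sub(3)]
              m_assoc)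
        moreover have "n \<in> L" using hn NL by blast
        ultimately have "h \<in> L"
          using x normal_imp_subgroup[OF L(1)] by (simp add: subgroup.m_closed subgroup.m_inv_closed)
        then show ?thesis using hn LH set_multI[of h K n N] by auto
      qed
      then show False using L by blast
    qed
  qed
qed

section \<open>Cyclic chief factors below a product of normal subgroups\<close>

lemma rcos_int_pow_eq:
  assumes N: "N \<lhd> G" and ab: "a \<in> carrier G" "b \<in> carrier G" "N #> a = N #> b"
  shows "N #> a [^] (i::int) = N #> b [^] i"
  using normal.FactGroup_int_pow[OF N, of a i] normal.FactGroup_int_pow[OF N, of b i] ab by simp

lemma cyclic_mod_from_Int:
  assumes K: "subgroup K G" and HN: "subgroup (H \<inter> N) G" and H: "H = K <#> (H \<inter> N)"
    and c: "cyclic_mod G (H \<inter> N) (K \<inter> N)"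
  shows "cyclic_mod G H K"
proof -
  obtain h where h: "h \<in> H \<inter> N" "\<And>x. x \<in> H \<inter> N \<Longrightarrow> \<exists>i::int. \<exists>k\<in>K \<inter> N. x = k \<otimes> h [^] i"
    using c by (auto simp: cyclic_mod_def)
  have "\<exists>i::int. \<exists>k\<in>K. x = k \<otimes> h [^] i" if x: "x \<in> H" for x
  proof -
    obtain k y where ky: "k \<in> K" "y \<in> H \<inter> N" "x = k \<otimes> y"
      using x H mem_set_mult_iff[of x K "H \<inter> N"] by auto
    obtain i :: int and k' where "k' \<in> K" "y = k' \<otimes> h [^] i"
      using h(2)[OF ky(2)] by blast
    then have "x = (k \<otimes> k') \<otimes> h [^] i" "k \<otimes> k' \<in> K"
      using ky h(1) subgroup.mem_carrier[OF K] subgroup.mem_carrier[OF HN]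
      by (simp_all add: m_assoc subgroup.m_closed[OF K])
    then show ?thesis by blast
  qed
  then show ?thesis
    using h(1) by (auto simp: cyclic_mod_def)
qed

text \<open>The component in \<open>H\<close> of a generator already generates H/K: powers of
  \<open>h \<otimes> n\<close> and of \<open>h\<close> agree modulo \<open>N\<close>, and the
  remaining factor lies in \<open>H\<close> and in \<open>K <#> N\<close>, hence in \<open>K\<close>
  by Dedekind's law.\<close>

lemma cyclic_mod_from_set_mult:
  assumes ch: "chief_factor G H K" and N: "N \<lhd> G" and le: "H \<inter> N \<subseteq> K"
    and c: "cyclic_mod G (H <#> N) (K <#> N)"
  shows "cyclic_mod G H K"
proof -
  note ch = chief_factorD[OF ch]
  note sub = normal_imp_subgroup[OF ch(1)] normal_imp_subgroup[OF ch(2)] normal_imp_subgroup[OF N]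
  note KN = normal_subgroup_set_mult_closed[OF ch(2) N]
  note mem = sub[THEN subgroup.mem_carrier]
  obtain h n where hn: "h \<in> H" "n \<in> N"
    and gen: "\<And>x. x \<in> H <#> N \<Longrightarrow> \<exists>i::int. \<exists>k\<in>K <#> N. x = k \<otimes> (h \<otimes> n) [^] i"
    using c unfolding cyclic_mod_def set_mult_def by auto
  have "\<exists>i::int. \<exists>k\<in>K. x = k \<otimes> h [^] i" if x: "x \<in> H" for x
  proof -
    have "x \<in> H <#> N" using x normal_set_mult_subsets(1)[OF ch(1) N] by blast
    then obtain i :: int and k where ik: "k \<in> K <#> N" "x = k \<otimes> (h \<otimes> n) [^] i"
      using gen by blast
    have kc: "k \<in> carrier G"
      using ik KN by (metis normal_imp_subgroup subgroup.mem_carrier)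
    have "N #> (h \<otimes> n) = N #> h"
      using hn mem normal.inv_op_closed2[OF N, of h n]
      by (intro repr_independence[symmetric]) (auto simp: r_coset_def intro!: bexI[of _ "h \<otimes> n \<otimes> inv h"] simp: m_assoc sub)
    then have "N #> (h \<otimes> n) [^] i = N #> h [^] i"
      using rcos_int_pow_eq[OF N] hn mem by simp
    then have "(h \<otimes> n) [^] i \<in> N #> h [^] i"
      using rcos_self[of "(h \<otimes> n) [^] i" N] hn mem sub by auto
    then obtain m where m: "m \<in> N" "(h \<otimes> n) [^] i = m \<otimes> h [^] i"
      by (auto simp: r_coset_def)
    have hi: "h [^] i \<in> H" using subgroup_int_pow_closed[OF sub(1) hn(1)] .
    have xe: "x = (k \<otimes> m) \<otimes> h [^] i"
      using ik m kc hn mem by (simp add: m_assoc)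
    then have "k \<otimes> m = x \<otimes> inv (h [^] i)"
      using kc m hn mem by (simp add: m_assoc)
    then have "k \<otimes> m \<in> H"
      using x hi sub(1) by (simp add: subgroup.m_closed subgroup.m_inv_closed)
    moreover have "k \<otimes> m \<in> K <#> N"
      using ik m normal_set_mult_subsets(2)[OF ch(2) N] normal_imp_subgroup[OF KN]
      by (blast intro: subgroup.m_closed)
    ultimately have "k \<otimes> m \<in> K"
      using Int_set_mult_le[OF ch(1,2) N _ le _ sub(2)] ch(3) by blast
    then show ?thesis using xe by blast
  qed
  then show ?thesis
    using hn(1) by (auto simp: cyclic_mod_def)
qed

text \<open>A chief factor H/K below the product is isomorphic either to one below \<open>N\<close>,
  by intersecting with \<open>N\<close>, or to HN/KN. The latter in turn is isomorphic to one below
  \<open>M\<close>.\<close>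

lemma hypercentral_set_mult:
  assumes M: "hypercentral G M" and N: "hypercentral G N"
  shows "hypercentral G (M <#> N)"
  unfolding hypercentral_def
proof (intro conjI allI impI)
  have MN: "M \<lhd> G" "N \<lhd> G" using assms by (auto simp: hypercentral_def)
  then show norm: "M <#> N \<lhd> G" by (rule normal_subgroup_set_mult_closed)
  fix H K assume "chief_factor G H K \<and> H \<subseteq> M <#> N"
  then have ch: "chief_factor G H K" and le: "H \<subseteq> M <#> N" by auto
  have *: "cyclic_mod G H K"
    if "hypercentral G L" "chief_factor G H K" "\<not> H \<inter> L \<subseteq> K" for H K L
  proof -
    have L: "L \<lhd> G" using that by (auto simp: hypercentral_def)
    note i = chief_factor_Int[OF that(2) L that(3)]
    show ?thesis
      by (rule cyclic_mod_from_Int[OF _ _ i(1)])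
        (use i(2) that chief_factorD(1,2)[OF i(2)] chief_factorD(2)[OF that(2)] in
          \<open>auto simp: hypercentral_def normal_imp_subgroup\<close>)
  qed
  show "cyclic_mod G H K"
  proof (cases "H \<inter> N \<subseteq> K")
    case False
    then show ?thesis using * N ch by blast
  next
    case True
    note chN = chief_factor_set_mult[OF ch MN(2) True]
    have HN: "subgroup (H <#> N) G" and KN: "subgroup (K <#> N) G"
      using chief_factorD[OF chN] by (simp_all add: normal_imp_subgroup)
    \<comment> \<open>Every element of HN is a product of some \<open>m\<close> in \<open>M\<close>
      and some \<open>n\<close> in \<open>N\<close>, where \<open>m\<close> again lies in HN. If all
      such \<open>m\<close> were in KN, then HN and KN would coincide.\<close>
    have "\<not> (H <#> N) \<inter> M \<subseteq> K <#> N"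
    proof
      assume sub: "(H <#> N) \<inter> M \<subseteq> K <#> N"
      have "x \<in> K <#> N" if x: "x \<in> H <#> N" for x
      proof -
        have NH: "N \<subseteq> H <#> N" and NK: "N \<subseteq> K <#> N"
          using normal_set_mult_subsets(2) chief_factorD(1,2)[OF ch] MN by blast+
        have "x \<in> M <#> N"
          using x le normal_set_mult_subsets(2)[OF MN] set_mult_subset_subgroup[OF normal_imp_subgroup[OF norm]]
          by blast
        then obtain m n where mn: "m \<in> M" "n \<in> N" "x = m \<otimes> n"
          by (auto simp: set_mult_def)
        then have "m = x \<otimes> inv n"
          using normal_imp_subgroup[THEN subgroup.mem_carrier, OF MN(1)]
            normal_imp_subgroup[THEN subgroup.mem_carrier, OF MN(2)] by (simp add: m_assoc)
        then have "m \<in> H <#> N"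
          using x subgroup.m_closed[OF HN x] subgroup.m_inv_closed[OF HN subsetD[OF NH mn(2)]]
          by simp
        then have "m \<in> K <#> N" using mn sub by blast
        then show ?thesis
          using subgroup.m_closed[OF KN _ subsetD[OF NK mn(2)]] mn(3) by simp
      qed
      then show False using chief_factorD(3)[OF chN] by blast
    qed
    then have "cyclic_mod G (H <#> N) (K <#> N)"
      using * M chN by blast
    then show ?thesis
      by (rule cyclic_mod_from_set_mult[OF ch MN(2) True])
  qed
qed

text \<open>A hypercentral subgroup of maximal order absorbs every other one, because their product
  is hypercentral too. Hence the description by \<open>GREATEST\<close> has an actual value.\<close>

lemma hypercentral_supersolvable_hypercenter:
  assumes fin: "finite (carrier G)"
  shows "hypercentral G (supersolvable_hypercenter G)"
proof -
  have "hypercentral G {\<one>}"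
    unfolding hypercentral_def
    using one_is_normal chief_factorD(2,3) normal_imp_subgroup subgroup.one_closed by blast
  moreover have "N \<subseteq> carrier G" if "hypercentral G N" for N
    using that by (auto simp: hypercentral_def dest!: normal_imp_subgroup subgroup.mem_carrier)
  ultimately obtain N where N: "hypercentral G N"
    and max: "\<And>M. hypercentral G M \<Longrightarrow> card M \<le> card N"
    using ex_has_greatest_nat[of "hypercentral G" "{\<one>}" card "Suc (order G)"] fin
    by (metis card_mono le_imp_less_Suc order_def)
  have "M \<subseteq> N" if M: "hypercentral G M" for M
  proof -
    have MN: "M \<lhd> G" "N \<lhd> G" using M N by (auto simp: hypercentral_def)
    have hc: "hypercentral G (M <#> N)" by (rule hypercentral_set_mult[OF M N])
    then have "M <#> N \<subseteq> carrier G"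
      by (auto simp: hypercentral_def dest!: normal_imp_subgroup subgroup.mem_carrier)
    then have "N = M <#> N"
      using max[OF hc] normal_set_mult_subsets(2)[OF MN] fin
      by (metis card_seteq finite_subset)
    then show ?thesis using normal_set_mult_subsets(1)[OF MN] by simp
  qed
  then have great: "(GREATEST N. hypercentral G N) = N"
    using N by (intro Greatest_equality) auto
  have "hypercentral G = (\<lambda>N. N \<lhd> G \<and>
        (\<forall>H K. chief_factor G H K \<and> H \<subseteq> N \<longrightarrow> cyclic_group (subgrp G H Mod K)))"
  proof -
    have "cyclic_group (subgrp G H Mod K) \<longleftrightarrow> cyclic_mod G H K" if "chief_factor G H K" for H K
      using chief_factorD[OF that]
      by (intro cyclic_group_Mod_iff normal_imp_subgroup normal_restrict_supergroup) auto
    then show ?thesis by (auto simp: hypercentral_def fun_eq_iff)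
  qed
  then show ?thesis
    using great N by (simp add: supersolvable_hypercenter_def)
qed

text \<open>The p-core is identified with the intersection of all conjugates of one Sylow subgroup
  \<open>S\<close>. A normal p-subgroup has a conjugate inside \<open>S\<close>, so by normality it
  lies in \<open>S\<close> itself.\<close>

lemma p_core_properties:
  assumes fin: "finite (carrier G)" and p: "Factorial_Ring.prime p"
  shows "p_core p G \<lhd> G" "p_subgroup p G (p_core p G)"
    "\<And>N. N \<lhd> G \<Longrightarrow> p_subgroup p G N \<Longrightarrow> N \<subseteq> p_core p G"
proof -
  have "p_subgroup p G {\<one>}"
    by (auto simp: p_subgroup_def triv_subgroup intro: exI[of _ 0])
  then obtain S where S: "sylow_subgroup p G S"
    using sylow_superset[OF fin p] by blast
  then have Ss: "subgroup S G" by (simp add: sylow_subgroup_def)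
  define N where "N = {x \<in> S. \<forall>g\<in>carrier G. conjugate G g x \<in> S}"
  have mem: "x \<in> carrier G" if "x \<in> N" for x
    using that subgroup.mem_carrier[OF Ss] by (simp add: N_def)
  have sub: "subgroup N G"
  proof (rule subgroupI)
    show "N \<subseteq> carrier G" using mem by blast
    show "N \<noteq> {}" 
      using subgroup.one_closed[OF Ss] by (auto simp: N_def)
    fix x assume x: "x \<in> N"
    have "conjugate G g (inv x) = inv (conjugate G g x)" if "g \<in> carrier G" for g
      using group_hom.hom_inv[OF conjugate_group_hom[OF that]] mem[OF x] by simp
    then show "inv x \<in> N"
      using x by (simp add: N_def subgroup.m_inv_closed[OF Ss])
    fix y assume y: "y \<in> N"
    show "x \<otimes> y \<in> N"
      using x y mem[OF x] mem[OF y]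
      by (auto simp: N_def conjugate_mult intro: subgroup.m_closed[OF Ss])
  qed
  moreover have "conjugate G g x \<in> N" if "g \<in> carrier G" "x \<in> N" for g x
  proof -
    have "conjugate G h (conjugate G g x) \<in> S" if "h \<in> carrier G" for h
      using \<open>g \<in> carrier G\<close> \<open>x \<in> N\<close> mem[OF \<open>x \<in> N\<close>] that
      by (simp add: N_def flip: conjugate_conjugate)
    then show ?thesis using that by (simp add: N_def)
  qed
  ultimately have N: "N \<lhd> G" by (simp add: normal_iff_conjugate)
  have "card N dvd card S"
    by (rule card_subgroup_dvd[OF fin sub Ss]) (auto simp: N_def)
  then have pN: "p_subgroup p G N"
    using sub S divides_primepow_nat[OF p] by (auto simp: p_subgroup_def sylow_subgroup_def)
  have le: "M \<subseteq> N" if M: "M \<lhd> G" "p_subgroup p G M" for M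
  proof
    obtain g where g: "g \<in> carrier G" "conjugate G g ` M \<subseteq> S"
      using sylow_conjugate[OF fin p S M(2)] by blast
    have MS: "y \<in> S" if "y \<in> M" for y
    proof -
      have "y \<in> carrier G" using subgroup.mem_carrier[OF normal_imp_subgroup[OF M(1)] that] .
      then have "y = conjugate G g (conjugate G (inv g) y)" "conjugate G (inv g) y \<in> M"
        using g that by (simp_all add: normal_conjugate[OF M(1)])
      then show ?thesis using g by (metis imageI subsetD)
    qed
    fix x assume "x \<in> M"
    then show "x \<in> N" using MS normal_conjugate[OF M(1)] by (simp add: N_def)
  qed
  have "p_core p G = N"
    unfolding p_core_def using N pN le by (intro Greatest_equality) auto
  then show "p_core p G \<lhd> G" "p_subgroup p G (p_core p G)"
    "\<And>N. N \<lhd> G \<Longrightarrow> p_subgroup p G N \<Longrightarrow> N \<subseteq> p_core p G"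
    using N pN le by simp_all
qed

end

section \<open>Action of p-elements on chief factors\<close>

text \<open>Fermat's little theorem, iterated.\<close>

lemma prime_power_power_cong_self:
  fixes j p :: nat
  assumes "Factorial_Ring.prime p"
  shows "[j ^ (p ^ m) = j] (mod p)"
proof (induction m)
  case (Suc m)
  have "[j ^ p = j] (mod p)"
  proof (cases "p dvd j")
    case True
    moreover have "p dvd j ^ p" using True assms prime_gt_0_nat by (metis dvd_power dvd_trans)
    ultimately show ?thesis by (metis cong_0_iff cong_sym cong_trans)
  next
    case False
    then have "[j * j ^ (p - 1) = j * 1] (mod p)"
      using fermat_theorem[OF assms] by (intro cong_mult cong_refl)
    then show ?thesis
      using assms prime_gt_0_nat by (simp flip: power_Suc)
  qed
  then have "[(j ^ p) ^ (p ^ m) = j ^ (p ^ m)] (mod p)" by (rule cong_pow)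
  then show ?case using Suc by (simp add: power_mult) (metis cong_trans)
qed simp

context group
begin

lemma subgroup_pow_card:
  assumes P: "subgroup P G" "finite P" and x: "x \<in> P"
  shows "x [^] card P = \<one>"
proof -
  interpret P: group "subgrp G P" by (rule subgroup_imp_group[OF P(1)])
  show ?thesis
    using P.pow_order_eq_1[of x] x P by (simp add: order_def flip: nat_pow_consistent)
qed

lemma conjugate_nat_pow:
  "g \<in> carrier G \<Longrightarrow> x \<in> carrier G \<Longrightarrow> conjugate G g (x [^] (n::nat)) = conjugate G g x [^] n"
  using group_hom.hom_nat_pow[OF conjugate_group_hom] by simp

lemma conjugate_int_pow:
  "g \<in> carrier G \<Longrightarrow> x \<in> carrier G \<Longrightarrow> conjugate G g (x [^] (i::int)) = conjugate G g x [^] i"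
  using group_hom.hom_int_pow[OF conjugate_group_hom] by simp

lemma conjugate_iterate_power:
  assumes "s \<in> carrier G" "a \<in> carrier G" "conjugate G s a = a [^] (j::nat)"
  shows "conjugate G (s [^] (n::nat)) a = a [^] (j ^ n)"
proof (induction n)
  case (Suc n)
  have "conjugate G (s [^] Suc n) a = conjugate G s (a [^] (j ^ n))"
    using assms Suc by (simp add: conjugate_conjugate)
  also have "\<dots> = a [^] (j ^ Suc n)"
    using assms by (simp add: conjugate_nat_pow nat_pow_pow)
  finally show ?case .
qed (use assms in simp)

text \<open>If \<open>s\<close> raises \<open>a\<close> to the power k, then its power with exponent
  \<open>p ^ m\<close>, which is trivial, raises \<open>a\<close> to the power k^(p^m). By Fermat
  this exponent is congruent to k modulo p, the order of \<open>a\<close>; so k acts as 1.\<close>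

lemma p_element_centralizes_order_p:
  fixes p :: nat
  assumes p: "Factorial_Ring.prime p" and s: "s \<in> carrier G" "s [^] (p ^ m) = \<one>"
    and a: "a \<in> carrier G" "a [^] p = \<one>" and conj: "conjugate G s a = a [^] (j::int)"
  shows "conjugate G s a = a"
proof (cases "a = \<one>")
  case False
  have "ord a dvd p" using a pow_eq_id by blast
  moreover have "ord a \<noteq> 1" using False a ord_eq_1 by blast
  ultimately have ord: "ord a = p" using p by (metis One_nat_def prime_nat_iff)
  \<comment> \<open>A natural representative of the integer exponent, so that it can itself be
    raised to powers.\<close>
  define k where "k = nat (j mod int p)"
  have k: "int k = j mod int p"
    using p prime_gt_0_nat by (simp add: k_def)
  have pow: "a [^] i = a [^] i'" if "[i = i'] (mod int p)" for i i' :: int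
    using that int_pow_eq[OF a(1), of i i'] ord by (simp add: cong_iff_dvd_diff dvd_diff_commute)
  have "conjugate G s a = a [^] int k"
    using conj pow[of j "int k"] k by (simp add: cong_def)
  then have ck: "conjugate G s a = a [^] k" by (simp add: int_pow_int)
  have "a = a [^] (k ^ (p ^ m))"
    using conjugate_iterate_power[OF s(1) a(1) ck, of "p ^ m"] s a by simp
  also have "a [^] (k ^ (p ^ m)) = a [^] k"
    using pow[of "int (k ^ (p ^ m))" "int k"] prime_power_power_cong_self[OF p, of k m]
    by (simp only: int_pow_int cong_int_iff)
  finally show ?thesis using ck by simp
qed (use s in simp)

text \<open>The elements whose cosets are p-th powers in the cyclic group H/K form a normal subgroup
  \<open>M\<close> between \<open>K\<close> and \<open>H\<close>, so \<open>M\<close> is one of the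
  two. If it is \<open>K\<close>, the exponent claim is immediate. If it is \<open>H\<close>, the
  coset of \<open>h\<close> has order dividing both some p i - 1 and a power of p, so H/K is trivial
  and the claim holds again.\<close>

lemma chief_p_factor_exponent:
  assumes fin: "finite (carrier G)" and p: "Factorial_Ring.prime p"
    and ch: "chief_factor G H K" and Hp: "card H = p ^ n"
    and h: "h \<in> H" and gen: "\<And>x. x \<in> H \<Longrightarrow> \<exists>i::int. \<exists>k\<in>K. x = k \<otimes> h [^] i"
  shows "K #> h [^] p = K"
proof -
  note ch = chief_factorD[OF ch]
  interpret K: normal K G by (rule ch(2))
  note mem = subgroup.mem_carrier[OF normal_imp_subgroup[OF ch(1)]]
  interpret Q: group "G Mod K" by (rule K.factorgroup_is_group)
  interpret \<phi>: group_hom G "G Mod K" "\<lambda>x. K #> x"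
    by (intro group_hom.intro group_hom_axioms.intro is_group Q.is_group K.r_coset_hom_Mod)
  have hc: "h \<in> carrier G" using mem h .
  note coset = rcos_eq_iff[OF K.is_subgroup]
  define q where "q = int p"
  define M where "M = {x \<in> carrier G. \<exists>i::int. K #> x = K #> h [^] (q * i)}"
  have "M \<lhd> G"
    unfolding normal_iff_conjugate
  proof (intro conjI ballI)
    show "subgroup M G"
    proof (rule subgroupI)
      have "K #> \<one> = K #> h [^] (q * 0)" by simp
      then show "M \<noteq> {}" unfolding M_def by blast
      fix x assume "x \<in> M"
      then obtain i where x: "x \<in> carrier G" "K #> x = K #> h [^] (q * i)"
        by (auto simp: M_def)
      have "K #> inv x = inv\<^bsub>G Mod K\<^esub> (K #> h [^] (q * i))"
        using x \<phi>.hom_inv[of x] by simp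
      also have "\<dots> = K #> h [^] (q * (- i))"
        using hc \<phi>.hom_inv[of "h [^] (q * i)"] by (simp add: int_pow_neg)
      finally show "inv x \<in> M" using x unfolding M_def by blast
      fix y assume "y \<in> M"
      then obtain j where y: "y \<in> carrier G" "K #> y = K #> h [^] (q * j)"
        by (auto simp: M_def)
      have "K #> (x \<otimes> y) = K #> (h [^] (q * i) \<otimes> h [^] (q * j))"
        using x y hc \<phi>.hom_mult by simp
      also have "h [^] (q * i) \<otimes> h [^] (q * j) = h [^] (q * (i + j))"
        using hc by (simp add: int_pow_mult distrib_left)
      finally show "x \<otimes> y \<in> M" using x y unfolding M_def by blast
    qed (auto simp: M_def)
  next
    fix g x assume g: "g \<in> carrier G" and "x \<in> M"
    then obtain i where x: "x \<in> carrier G" "K #> x = K #> h [^] (q * i)"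
      by (auto simp: M_def)
    obtain k where k: "k \<in> K" "x = k \<otimes> h [^] (q * i)"
      using coset[of x "h [^] (q * i)"] x hc by auto
    obtain j :: int and k' where j: "k' \<in> K" "conjugate G g h = k' \<otimes> h [^] j"
      using gen[OF normal_conjugate[OF ch(1) g h]] by blast
    then have j: "K #> conjugate G g h = K #> h [^] j"
      using coset[of "conjugate G g h" "h [^] j"] g hc by auto
    let ?z = "conjugate G g h [^] (q * i)"
    have "conjugate G g x = conjugate G g k \<otimes> conjugate G g h [^] (q * i)"
      using k g hc K.mem_carrier by (simp add: conjugate_mult conjugate_int_pow)
    then have "K #> conjugate G g x = K #> conjugate G g h [^] (q * i)"
      using coset[of "conjugate G g x" ?z] normal_conjugate[OF ch(2) g k(1)] g hc x(1)
      by (metis conjugate_closed int_pow_closed)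
    also have "\<dots> = K #> (h [^] j) [^] (q * i)"
      using rcos_int_pow_eq[OF ch(2) _ _ j] g hc by simp
    also have "(h [^] j) [^] (q * i) = h [^] (q * (i * j))"
      using hc by (simp add: int_pow_pow ac_simps)
    finally show "conjugate G g x \<in> M" using g x unfolding M_def by auto
  qed
  moreover have "K \<subseteq> M"
  proof
    fix k assume "k \<in> K"
    then have "K #> k = K #> h [^] (q * 0)"
      using coset[of k \<one>] K.mem_carrier by auto
    then show "k \<in> M" using \<open>k \<in> K\<close> K.mem_carrier unfolding M_def by blast
  qed
  moreover have "M \<subseteq> H"
  proof
    fix x assume "x \<in> M"
    then obtain i k where "k \<in> K" "x = k \<otimes> h [^] (q * i)"
      unfolding M_def using coset hc by auto
    then show "x \<in> H"
      using ch(3) subgroup.m_closed[OF normal_imp_subgroup[OF ch(1)]]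
        subgroup_int_pow_closed[OF normal_imp_subgroup[OF ch(1)] h] by blast
  qed
  ultimately consider "M = K" | "M = H" using ch(4) by blast
  then show ?thesis
  proof cases
    case 1
    have "h [^] p \<in> M"
      unfolding M_def q_def using hc int_pow_int[of G h p] by (auto intro!: exI[of _ 1])
    then show ?thesis using 1 K.rcos_const by simp
  next
    case 2
    then obtain i where "K #> h = K #> h [^] (q * i)" using h by (auto simp: M_def)
    let ?a = "K #> h"
    have a: "?a \<in> carrier (G Mod K)" using hc by (simp add: \<phi>.hom_closed)
    have "?a [^]\<^bsub>G Mod K\<^esub> (1::int) = ?a [^]\<^bsub>G Mod K\<^esub> (q * i)"
      using \<open>K #> h = _\<close> \<phi>.hom_int_pow[OF hc] a by (simp del: \<phi>.hom_int_pow)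
    then have "int (Q.ord ?a) dvd q * i - 1"
      using Q.int_pow_eq[OF a] by (metis minus_diff_eq dvd_minus_iff)
    moreover have "Q.ord ?a dvd p ^ n"
    proof -
      have "h [^] (p ^ n) = \<one>"
        using subgroup_pow_card[OF normal_imp_subgroup[OF ch(1)] _ h] Hp
          finite_subset[OF subgroup.subset[OF normal_imp_subgroup[OF ch(1)]] fin] by simp
      then have "?a [^]\<^bsub>G Mod K\<^esub> (p ^ n) = \<one>\<^bsub>G Mod K\<^esub>"
        using \<phi>.hom_nat_pow[OF hc, of "p ^ n"] \<phi>.hom_one by simp
      then show ?thesis using Q.pow_eq_id[OF a] by simp
    qed
    ultimately have "Q.ord ?a = 1"
    proof -
      obtain e where e: "Q.ord ?a = p ^ e"
        using \<open>Q.ord ?a dvd p ^ n\<close> divides_primepow_nat[OF p] by blast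
      have "e = 0"
      proof (rule ccontr)
        assume "e \<noteq> 0"
        then have "q dvd int (Q.ord ?a)" unfolding e q_def by simp
        then have "q dvd q * i - 1" using \<open>int (Q.ord ?a) dvd q * i - 1\<close> dvd_trans by blast
        then have "q dvd 1" by (metis dvd_diffD1 dvd_triv_left dvd_diff_commute diff_diff_eq2 dvd_diff add_diff_cancel_left')
        then show False using p by (simp add: q_def not_prime_unit)
      qed
      then show ?thesis using e by simp
    qed
    then have "?a = K" using Q.ord_eq_1[OF a] by simp
    then have "?a [^]\<^bsub>G Mod K\<^esub> p = K"
      using Q.nat_pow_one[of p] by simp
    then show ?thesis using \<phi>.hom_nat_pow[OF hc, of p] by simp
  qed
qed

text \<open>In the quotient by \<open>K\<close> the coset of \<open>t\<close> is a p-element acting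
  on a cyclic group of exponent p. Triviality of this action is stated as membership of the
  commutator x^-1 x^t in \<open>K\<close>.\<close>

lemma p_element_centralizes_chief_p_factor:
  assumes fin: "finite (carrier G)" and p: "Factorial_Ring.prime p"
    and ch: "chief_factor G H K" and Hp: "card H = p ^ n" and cyc: "cyclic_mod G H K"
    and t: "t \<in> carrier G" "t [^] (p ^ m) = \<one>" and x: "x \<in> H"
  shows "inv x \<otimes> conjugate G t x \<in> K"
proof -
  obtain h where h: "h \<in> H" and gen: "\<And>x. x \<in> H \<Longrightarrow> \<exists>i::int. \<exists>k\<in>K. x = k \<otimes> h [^] i"
    using cyc by (auto simp: cyclic_mod_def)
  note e = chief_p_factor_exponent[OF fin p ch Hp h gen]
  note ch = chief_factorD[OF ch]
  interpret K: normal K G by (rule ch(2))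
  note mem = subgroup.mem_carrier[OF normal_imp_subgroup[OF ch(1)]]
  interpret Q: group "G Mod K" by (rule K.factorgroup_is_group)
  interpret \<phi>: group_hom G "G Mod K" "\<lambda>x. K #> x"
    by (intro group_hom.intro group_hom_axioms.intro is_group Q.is_group K.r_coset_hom_Mod)
  have hc: "h \<in> carrier G" using mem h .
  have conj: "K #> conjugate G g y = conjugate (G Mod K) (K #> g) (K #> y)"
    if "g \<in> carrier G" "y \<in> carrier G" for g y
    using that by (simp add: conjugate_def \<phi>.hom_mult \<phi>.hom_inv)
  have pow: "y \<in> H \<Longrightarrow> \<exists>i::int. K #> y = (K #> h) [^]\<^bsub>G Mod K\<^esub> i" for y
  proof -
    assume "y \<in> H"
    then obtain i :: int and k where k: "k \<in> K" "y = k \<otimes> h [^] i" using gen by blast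
    then have "K #> y = K #> h [^] i"
      using hc \<phi>.hom_mult[of k "h [^] i"] K.rcos_const Q.l_one[of "K #> h [^] i"]
        \<phi>.hom_closed[of "h [^] i"] by simp
    then show ?thesis using \<phi>.hom_int_pow[OF hc, of i] by auto
  qed
  let ?a = "K #> h" and ?s = "K #> t"
  have as: "?a \<in> carrier (G Mod K)" "?s \<in> carrier (G Mod K)"
    using hc t by (simp_all add: \<phi>.hom_closed)
  obtain j :: int where "K #> conjugate G t h = ?a [^]\<^bsub>G Mod K\<^esub> j"
    using pow normal_conjugate[OF ch(1) t(1) h] by blast
  then have "conjugate (G Mod K) ?s ?a = ?a [^]\<^bsub>G Mod K\<^esub> j"
    using conj[OF t(1) hc] by simp
  moreover have "?s [^]\<^bsub>G Mod K\<^esub> (p ^ m) = \<one>\<^bsub>G Mod K\<^esub>"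
    using \<phi>.hom_nat_pow[OF t(1), of "p ^ m"] t(2) \<phi>.hom_one by simp
  moreover have "?a [^]\<^bsub>G Mod K\<^esub> p = \<one>\<^bsub>G Mod K\<^esub>"
    using \<phi>.hom_nat_pow[OF hc, of p] e by simp
  ultimately have fix_a: "conjugate (G Mod K) ?s ?a = ?a"
    using Q.p_element_centralizes_order_p[OF p as(2) _ as(1)] by blast
  obtain i :: int where "K #> x = ?a [^]\<^bsub>G Mod K\<^esub> i" using pow[OF x] by blast
  then have "conjugate (G Mod K) ?s (K #> x) = K #> x"
    using Q.conjugate_int_pow[OF as(2,1)] fix_a by simp
  then have eq: "K #> conjugate G t x = K #> x"
    using conj[OF t(1) mem[OF x]] by simp
  have "K #> (inv x \<otimes> conjugate G t x) = K #> (inv x \<otimes> x)"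
    using \<phi>.hom_mult[of "inv x" "conjugate G t x"] \<phi>.hom_mult[of "inv x" x] mem[OF x] t(1) eq
    by (metis conjugate_closed inv_closed)
  also have "inv x \<otimes> x = \<one>" using mem[OF x] by simp
  finally have "K #> (inv x \<otimes> conjugate G t x) = K" using K.subset by simp
  then show ?thesis
    using rcos_self[of "inv x \<otimes> conjugate G t x" K] mem[OF x] t(1) K.is_subgroup by simp
qed

section \<open>Coprime action and the common centralizer of chief factors\<close>

lemma ex_chief_factor:
  assumes fin: "finite (carrier G)" and N: "N \<lhd> G" "N \<noteq> {\<one>}"
  shows "\<exists>K. chief_factor G N K"
proof -
  let ?P = "\<lambda>K. K \<lhd> G \<and> K \<subset> N"
  have Ns: "N \<subseteq> carrier G" "\<one> \<in> N"
    using normal_imp_subgroup[OF N(1)] by (simp_all add: subgroup.subset subgroup.one_closed)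
  then have "?P {\<one>}" using N one_is_normal by auto
  moreover have "\<forall>K. ?P K \<longrightarrow> card K < Suc (card N)"
    using finite_subset[OF Ns(1) fin] by (simp add: card_mono less_Suc_eq_le psubset_imp_subset)
  ultimately obtain K where K: "?P K" and max: "\<And>L. ?P L \<Longrightarrow> card L \<le> card K"
    using ex_has_greatest_nat[of ?P "{\<one>}" card "Suc (card N)"] by auto
  have "\<not> (\<exists>L. L \<lhd> G \<and> K \<subset> L \<and> L \<subset> N)"
  proof
    assume "\<exists>L. L \<lhd> G \<and> K \<subset> L \<and> L \<subset> N"
    then obtain L where L: "L \<lhd> G" "K \<subset> L" "L \<subset> N" by blast
    then have "finite L" using Ns fin by (meson finite_subset psubset_imp_subset)
    then show False using max[of L] L psubset_card_mono[of L K] by simp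
  qed
  then show ?thesis using K N unfolding chief_factor_def by blast
qed

text \<open>Induction along a chief series. The commutator \<open>y\<close> of \<open>x\<close> and
  \<open>d\<close> lies in \<open>K\<close>, where \<open>d\<close> already acts trivially, so
  iterating gives x y^n for the conjugate of \<open>x\<close> by d^n. At n = m this yields y^m = 1,
  while \<open>y\<close> is a p-element and m is prime to p.\<close>

lemma coprime_element_centralizes:
  assumes fin: "finite (carrier G)" and Q: "Q \<lhd> G" "card Q = p ^ k"
    and d: "d \<in> carrier G" "d [^] (m::nat) = \<one>" and cop: "coprime m p"
    and triv: "\<And>H K x. chief_factor G H K \<Longrightarrow> H \<subseteq> Q \<Longrightarrow> x \<in> H \<Longrightarrow> inv x \<otimes> conjugate G d x \<in> K"
  shows "d \<in> centralizer_of G Q"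
proof -
  note Qs = normal_imp_subgroup[OF Q(1)]
  have finQ: "finite Q" using finite_subset[OF subgroup.subset[OF Qs] fin] .
  have "\<forall>x\<in>N. conjugate G d x = x" if "N \<lhd> G" "N \<subseteq> Q" for N
    using that
  proof (induction "card N" arbitrary: N rule: less_induct)
    case less
    show ?case
    proof (cases "N = {\<one>}")
      case False
      then obtain K where ch: "chief_factor G N K"
        using ex_chief_factor[OF fin less.prems(1)] by blast
      note c = chief_factorD[OF ch]
      have "card K < card N"
        using c(3) less.prems(2) finQ finite_subset psubset_card_mono by metis
      then have IH: "conjugate G d y = y" if "y \<in> K" for y
        using less.hyps[OF _ c(2)] c(3) less.prems(2) that by blast
      show ?thesis
      proof
        fix x assume x: "x \<in> N"
        let ?y = "inv x \<otimes> conjugate G d x"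
        have xc: "x \<in> carrier G" using x subgroup.mem_carrier[OF normal_imp_subgroup[OF c(1)]] by blast
        have yK: "?y \<in> K" by (rule triv[OF ch less.prems(2) x])
        have yc: "?y \<in> carrier G" using xc d by simp
        have dx: "conjugate G d x = x \<otimes> ?y"
          using xc d by (simp flip: m_assoc)
        have "conjugate G (d [^] n) x = x \<otimes> ?y [^] n" for n :: nat
        proof (induction n)
          case (Suc n)
          have "conjugate G (d [^] Suc n) x = conjugate G d (x \<otimes> ?y [^] n)"
            using Suc d xc by (simp add: conjugate_conjugate)
          also have "\<dots> = x \<otimes> ?y \<otimes> ?y [^] n"
            using d(1) xc yc dx IH[OF yK] by (metis conjugate_mult conjugate_nat_pow nat_pow_closed)
          also have "\<dots> = x \<otimes> ?y [^] Suc n"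
            using xc yc by (metis m_assoc nat_pow_Suc2 nat_pow_closed)
          finally show ?case .
        qed (use xc in simp)
        from this[of m] have "x = x \<otimes> ?y [^] m" using d xc by simp
        then have "?y [^] m = \<one>" using xc yc by (metis l_cancel_one' nat_pow_closed)
        moreover have "?y [^] (p ^ k) = \<one>"
          using subgroup_pow_card[OF Qs finQ, of ?y] yK c(3) less.prems(2) Q(2) by auto
        ultimately have "ord ?y dvd m" "ord ?y dvd p ^ k"
          using pow_eq_id[OF yc] by simp_all
        then have "ord ?y = 1"
          using cop by (metis coprime_common_divisor_nat coprime_power_right_iff)
        then have "?y = \<one>" using ord_eq_1[OF yc] by simp
        then show "conjugate G d x = x" using dx xc by simp
      qed
    qed (use d in simp)
  qed
  then show ?thesis using d Q by (simp add: centralizer_of_def)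
qed

text \<open>\<open>D\<close> is the intersection of the centralizers in \<open>G\<close> of the
  chief factors below \<open>Q\<close>. Closure under products is the commutator identity [x, gh] =
  [x, h] [x, g]^h together with normality of \<open>K\<close>.\<close>

lemma trivial_on_chief_factors_subgroup:
  fixes Q
  defines "D \<equiv> {g \<in> carrier G. \<forall>H K. chief_factor G H K \<and> H \<subseteq> Q \<longrightarrow>
    (\<forall>x\<in>H. inv x \<otimes> conjugate G g x \<in> K)}"
  shows "subgroup D G"
proof (rule subgroupI)
  show "D \<subseteq> carrier G" by (auto simp: D_def)
  have "inv x \<otimes> conjugate G \<one> x \<in> K" if "chief_factor G H K" "x \<in> H" for H K x
    using chief_factorD(1,2)[OF that(1)] that(2)
    by (metis conjugate_one l_inv normal_imp_subgroup subgroup.mem_carrier subgroup.one_closed)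
  then have "\<one> \<in> D" by (auto simp: D_def)
  then show "D \<noteq> {}" by blast
next
  fix g assume g: "g \<in> D"
  then have gc: "g \<in> carrier G" by (simp add: D_def)
  have "inv x \<otimes> conjugate G (inv g) x \<in> K" if ch: "chief_factor G H K" "H \<subseteq> Q" "x \<in> H" for H K x
  proof -
    note c = chief_factorD[OF ch(1)]
    \<comment> \<open>For inverses, the condition on \<open>g\<close> is used at the preimage of
      \<open>x\<close> under conjugation by \<open>g\<close>, which again lies in
      \<open>H\<close>.\<close>
    let ?z = "conjugate G (inv g) x"
    have xc: "x \<in> carrier G" using ch(3) subgroup.mem_carrier[OF normal_imp_subgroup[OF c(1)]] by blast
    have "?z \<in> H" using normal_conjugate[OF c(1) _ ch(3)] gc by simp
    then have "inv ?z \<otimes> conjugate G g ?z \<in> K" using g ch by (auto simp: D_def)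
    then have "inv (inv ?z \<otimes> x) \<in> K"
      using xc gc subgroup.m_inv_closed[OF normal_imp_subgroup[OF c(2)]] by simp
    then show ?thesis using xc gc by (simp add: inv_mult_group)
  qed
  then show "inv g \<in> D" using gc by (auto simp: D_def)
next
  fix g h assume g: "g \<in> D" and h: "h \<in> D"
  then have gc: "g \<in> carrier G" and hc: "h \<in> carrier G" by (simp_all add: D_def)
  have "inv x \<otimes> conjugate G (g \<otimes> h) x \<in> K" if ch: "chief_factor G H K" "H \<subseteq> Q" "x \<in> H" for H K x
  proof -
    note c = chief_factorD[OF ch(1)]
    have xc: "x \<in> carrier G" using ch(3) subgroup.mem_carrier[OF normal_imp_subgroup[OF c(1)]] by blast
    let ?k = "inv x \<otimes> conjugate G g x"
    have k: "?k \<in> K" using g ch by (auto simp: D_def)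
    have "conjugate G (g \<otimes> h) x = conjugate G h (x \<otimes> ?k)"
      using xc gc hc by (simp add: conjugate_conjugate flip: m_assoc)
    also have "\<dots> = conjugate G h x \<otimes> conjugate G h ?k"
      using xc gc hc by (intro conjugate_mult) simp_all
    finally have "inv x \<otimes> conjugate G (g \<otimes> h) x = (inv x \<otimes> conjugate G h x) \<otimes> conjugate G h ?k"
      using xc gc hc by (simp add: m_assoc)
    moreover have "inv x \<otimes> conjugate G h x \<in> K" using h ch by (auto simp: D_def)
    ultimately show ?thesis
      using normal_conjugate[OF c(2) hc k] subgroup.m_closed[OF normal_imp_subgroup[OF c(2)]] by simp
  qed
  then show "g \<otimes> h \<in> D" using gc hc by (auto simp: D_def)
qed

text \<open>The p-parts are squeezed: the order of \<open>T\<close> divides that of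
  \<open>D\<close>, which divides that of \<open>G\<close>.\<close>

lemma sylow_in_subgroup:
  assumes fin: "finite (carrier G)" and T: "sylow_subgroup p G T" and D: "subgroup D G" "T \<subseteq> D"
    and p: "Factorial_Ring.prime p"
  shows "sylow_subgroup p (subgrp G D) T"
proof -
  have finD: "finite D" using finite_subset[OF subgroup.subset[OF D(1)] fin] .
  have cD: "card D \<noteq> 0"
    using finD subgroup.one_closed[OF D(1)] by (metis card_0_eq empty_iff)
  have Ts: "subgroup T G" "card T = p ^ multiplicity p (order G)"
    using T by (simp_all add: sylow_subgroup_def)
  have oG: "order G \<noteq> 0" using fin order_gt_0_iff_finite by simp
  have "card D dvd order G"
    using card_subgroup_dvd[OF fin D(1) subgroup_self subgroup.subset[OF D(1)]] by (simp add: order_def)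
  then have "multiplicity p (card D) \<le> multiplicity p (order G)"
    using oG by (rule dvd_imp_multiplicity_le)
  moreover have "card T dvd card D"
    by (rule card_subgroup_dvd[OF fin Ts(1) D])
  then have "multiplicity p (order G) \<le> multiplicity p (card D)"
    using Ts(2) cD p not_prime_unit by (auto intro!: multiplicity_geI)
  ultimately show ?thesis
    using Ts subgroup_incl[OF Ts(1) D] by (simp add: sylow_subgroup_def order_def)
qed

text \<open>Modulo the centralizer of \<open>Q\<close>, the elements acting trivially on all chief factors below \<open>Q\<close>
  form a normal Sylow subgroup; the claim then is a Frattini argument.\<close>

lemma sylow_normalizer_centralizer_factorization:
  assumes fin: "finite (carrier G)" and p: "Factorial_Ring.prime p"
    and Q: "Q \<lhd> G" "p_subgroup p G Q"
    and cyc: "\<And>H K. chief_factor G H K \<Longrightarrow> H \<subseteq> Q \<Longrightarrow> cyclic_mod G H K"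
    and T: "sylow_subgroup p G T" and l: "l \<in> carrier G"
  shows "\<exists>c\<in>centralizer_of G Q. conjugate G (l \<otimes> c) ` T = T"
proof -
  define D where "D = {g \<in> carrier G. \<forall>H K. chief_factor G H K \<and> H \<subseteq> Q \<longrightarrow>
    (\<forall>x\<in>H. inv x \<otimes> conjugate G g x \<in> K)}"
  let ?C = "centralizer_of G Q"
  have Ds: "subgroup D G" unfolding D_def by (rule trivial_on_chief_factors_subgroup)
  have finsub: "finite A" if "subgroup A G" for A
    using that fin finite_subset subgroup.subset by blast
  have Cn: "?C \<lhd> G" by (rule centralizer_of_normal[OF Q(1)])
  note Cs = normal_imp_subgroup[OF Cn]
  note Qs = normal_imp_subgroup[OF Q(1)]
  obtain k where k: "card Q = p ^ k" using Q(2) by (auto simp: p_subgroup_def)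
  have Ts: "subgroup T G" "card T = p ^ multiplicity p (order G)"
    using T by (simp_all add: sylow_subgroup_def)
  \<comment> \<open>Stated for all p-subgroups and not only for \<open>T\<close>, since it is needed
    again for the conjugate of \<open>T\<close> by \<open>l\<close>.\<close>
  have pD: "A \<subseteq> D" if A: "subgroup A G" "card A = p ^ m" for A m
  proof
    fix t assume "t \<in> A"
    then have t: "t \<in> carrier G" "t [^] (p ^ m) = \<one>"
      using subgroup.mem_carrier[OF A(1)] subgroup_pow_card[OF A(1) finsub[OF A(1)]] A(2)
      by auto
    have "inv x \<otimes> conjugate G t x \<in> K" if "chief_factor G H K" "H \<subseteq> Q" "x \<in> H" for H K x
    proof -
      have "card H dvd p ^ k"
        using card_subgroup_dvd[OF fin normal_imp_subgroup[OF chief_factorD(1)] Qs] that k by metis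
      then obtain n where "card H = p ^ n"
        using divides_primepow_nat[OF p] by blast
      then show ?thesis
        using p_element_centralizes_chief_p_factor[OF fin p that(1) _ cyc t] that by blast
    qed
    then show "t \<in> D" using t by (auto simp: D_def)
  qed
  have CD: "?C \<subseteq> D"
  proof
    fix c assume c: "c \<in> ?C"
    have "inv x \<otimes> conjugate G c x \<in> K" if "chief_factor G H K" "H \<subseteq> Q" "x \<in> H" for H K x
    proof -
      have "conjugate G c x = x" using c that by (auto simp: centralizer_of_def)
      moreover have "x \<in> carrier G" using subsetD[OF that(2,3)] subgroup.mem_carrier[OF Qs] by simp
      ultimately show ?thesis
        using subgroup.one_closed[OF normal_imp_subgroup[OF chief_factorD(2)[OF that(1)]]] by simp
    qed
    then show "c \<in> D" using c unfolding D_def centralizer_of_def by blast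
  qed
  have CT: "subgroup (?C <#> T) G"
    by (intro second_isomorphism_grp.normal_set_mult_subgroup second_isomorphism_grp.intro Cn
        second_isomorphism_grp_axioms.intro Ts(1))
  have CTD: "?C <#> T \<subseteq> D"
    by (rule set_mult_subset_subgroup[OF Ds CD pD[OF Ts]])
  have le: "?C \<subseteq> ?C <#> T" "T \<subseteq> ?C <#> T"
    using set_multI[of _ ?C \<one> T] set_multI[of \<one> ?C _ T] subgroup.one_closed[OF Ts(1)]
      subgroup.one_closed[OF Cs] subgroup.mem_carrier[OF Ts(1)] subgroup.mem_carrier[OF Cs]
    by fastforce+
  have pos: "card A \<noteq> 0" if "subgroup A G" for A
    using finsub[OF that] subgroup.one_closed[OF that] by (metis card_0_eq empty_iff)
  \<comment> \<open>Checked one prime at a time. For p, the Sylow subgroup \<open>T\<close> accounts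
    for the full p-part of \<open>D\<close>. For r different from p, a Sylow r-subgroup of
    \<open>D\<close> acts coprimely on \<open>Q\<close> and trivially on its chief factors, so it
    lies in \<open>?C\<close>. Divisibility then forces \<open>D = ?C <#> T\<close>.\<close>
  have "card D dvd card (?C <#> T)"
  proof (rule multiplicity_le_imp_dvd)
    show "card D \<noteq> 0" by (rule pos[OF Ds])
    fix r :: nat assume r: "Factorial_Ring.prime r"
    have "\<exists>R. subgroup R G \<and> R \<subseteq> ?C <#> T \<and> r ^ multiplicity r (card D) dvd card R"
    proof (cases "r = p")
      case True
      have "card T = p ^ multiplicity p (card D)"
        using sylow_in_subgroup[OF fin T Ds pD[OF Ts] p] by (simp add: sylow_subgroup_def order_def)
      then show ?thesis using True Ts(1) le(2) by auto
    next
      case False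
      interpret D: group "subgrp G D" by (rule subgroup_imp_group[OF Ds])
      have "p_subgroup r (subgrp G D) {\<one>}"
        using D.triv_subgroup by (auto simp: p_subgroup_def intro: exI[of _ 0])
      then obtain R where "sylow_subgroup r (subgrp G D) R"
        using D.sylow_superset[OF _ r] finsub[OF Ds] by auto
      then have RD: "subgroup R (subgrp G D)" and R: "card R = r ^ multiplicity r (card D)"
        by (simp_all add: sylow_subgroup_def order_def)
      have Rs: "subgroup R G" using incl_subgroup[OF Ds RD] .
      have "R \<subseteq> ?C"
      proof
        fix x assume x: "x \<in> R"
        have "x \<in> D" using subgroup.mem_carrier[OF RD x] by simp
        moreover have "x [^] card R = \<one>" by (rule subgroup_pow_card[OF Rs finsub[OF Rs] x])
        moreover have "coprime (card R) p"
          unfolding R using primes_coprime[OF r p False] by simp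
        ultimately show "x \<in> ?C"
          by (intro coprime_element_centralizes[OF fin Q(1) k]) (auto simp: D_def)
      qed
      then show ?thesis using Rs R le(1) by (metis dvd_refl order_trans)
    qed
    then obtain R where "subgroup R G" "R \<subseteq> ?C <#> T" "r ^ multiplicity r (card D) dvd card R"
      by blast
    then have "r ^ multiplicity r (card D) dvd card (?C <#> T)"
      using card_subgroup_dvd[OF fin _ CT] dvd_trans by blast
    then show "multiplicity r (card D) \<le> multiplicity r (card (?C <#> T))"
      using pos[OF CT] r not_prime_unit by (auto intro!: multiplicity_geI)
  qed
  then have "card D \<le> card (?C <#> T)"
    using pos[OF CT] by (simp add: dvd_imp_le)
  then have D_eq: "D = ?C <#> T"
    using CTD finsub[OF Ds] card_seteq by blast
  interpret D: group "subgrp G D" by (rule subgroup_imp_group[OF Ds])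
  let ?T' = "conjugate G l ` T"
  have T': "subgroup ?T' G" "card ?T' = p ^ multiplicity p (order G)"
    using subgroup_conjugate[OF l Ts(1)] card_conjugate[OF l subgroup.subset[OF Ts(1)]] Ts by auto
  have "p_subgroup p (subgrp G D) ?T'"
    using subgroup_incl[OF T'(1) Ds pD[OF T']] T'(2) by (auto simp: p_subgroup_def)
  \<comment> \<open>The Frattini step: \<open>T\<close> and its conjugate by \<open>l\<close> are
    p-subgroups of \<open>D\<close> of the same order, and \<open>T\<close> is Sylow there. Writing
    the conjugating element as \<open>c \<otimes> t\<close>, the part \<open>t\<close> normalizes
    \<open>T\<close> and can be removed, which leaves \<open>c\<close> in the centralizer.\<close>
  then have "\<exists>d\<in>D. conjugate (subgrp G D) d ` ?T' \<subseteq> T"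
    using D.sylow_conjugate[OF _ p sylow_in_subgroup[OF fin T Ds pD[OF Ts] p], of ?T'] finsub[OF Ds]
    by simp
  then obtain d where d: "d \<in> D" "conjugate (subgrp G D) d ` ?T' \<subseteq> T"
    by blast
  then have dT: "conjugate G d ` ?T' \<subseteq> T"
    using conjugate_subgrp[OF Ds d(1)] by (simp cong: image_cong)
  obtain c t where ct: "c \<in> ?C" "t \<in> T" "d = c \<otimes> t"
    using d(1) D_eq mem_set_mult_iff by auto
  have cc: "c \<in> carrier G" and tc: "t \<in> carrier G"
    using ct subgroup.mem_carrier[OF Cs] subgroup.mem_carrier[OF Ts(1)] by auto
  note Tc = subgroup.subset[OF Ts(1)]
  note T'c = subgroup.subset[OF T'(1)]
  have cT'c: "conjugate G c ` ?T' \<subseteq> carrier G"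
    using T'c cc by auto
  have "conjugate G c ` ?T' = conjugate G (inv t) ` conjugate G t ` conjugate G c ` ?T'"
    using conjugate_image_mult[of t "inv t" "conjugate G c ` ?T'"] tc cT'c by simp
  also have "\<dots> \<subseteq> conjugate G (inv t) ` T"
    using dT ct(3) conjugate_image_mult[OF cc tc T'c] by (intro image_mono) simp
  also have "\<dots> = T"
    using conjugate_image_subgroup[OF Ts(1) subgroup.m_inv_closed[OF Ts(1) ct(2)]] .
  finally have "conjugate G (l \<otimes> c) ` T \<subseteq> T"
    using conjugate_image_mult[OF l cc Tc] by simp
  then have "conjugate G (l \<otimes> c) ` T = T"
    using card_conjugate[of "l \<otimes> c" T] l cc Tc finsub[OF Ts(1)] by (simp add: card_subset_eq)
  then show ?thesis using ct(1) by blast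
qed

text \<open>The strict inequality of orders is the form in which growth feeds the induction on the
  index in \<open>S\<close>.\<close>

lemma normalizer_grows_in_p_subgroup:
  assumes fin: "finite (carrier G)" and p: "Factorial_Ring.prime p" and S: "p_subgroup p G S"
    and P: "subgroup P G" "P \<subset> S"
  shows "card P < card (S \<inter> normalizer_of G P)"
proof -
  have Ss: "subgroup S G" using S by (simp add: p_subgroup_def)
  interpret S: group "subgrp G S" by (rule subgroup_imp_group[OF Ss])
  have finS: "finite S" using finite_subset[OF subgroup.subset[OF Ss] fin] .
  obtain n where "card S = p ^ n" using S by (auto simp: p_subgroup_def)
  then obtain x where x: "x \<in> S - P" "conjugate (subgrp G S) x ` P \<subseteq> P"
    using S.p_group_normalizer_grows[OF _ p, of n P] finS P subgroup_incl[OF P(1) Ss]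
    by (auto simp: order_def)
  then have "conjugate G x ` P \<subseteq> P"
    using conjugate_subgrp[OF Ss, of x] by (simp cong: image_cong)
  then have "x \<in> normalizer_of G P"
    using x subgroup.mem_carrier[OF Ss] finS P subgroup.subset[OF P(1)]
    by (intro normalizer_ofI) (auto intro: finite_subset)
  then have "P \<subset> S \<inter> normalizer_of G P"
    using x P subgroup_le_normalizer_of[OF P(1)] by blast
  then show ?thesis using finS by (simp add: psubset_card_mono)
qed

end

section \<open>Control of fusion\<close>

text \<open>Needed in contrapositive form: if O_p of a local subgroup is not cyclic, neither is
  \<open>S\<close>, so the clause for order 4 becomes available. The generator is the power of
  \<open>x\<close> with the least positive exponent in \<open>A\<close>.\<close>

lemma (in group) subgroup_of_cyclic_group:
  assumes c: "cyclic_group G" and A: "subgroup A G"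
  shows "cyclic_group (subgrp G A)"
proof -
  obtain x where x: "x \<in> carrier G" "carrier G = range (\<lambda>n::int. x [^] n)"
    using c cyclic_group by blast
  interpret A: group "subgrp G A" by (rule subgroup_imp_group[OF A])
  have "\<exists>d::nat. x [^] d \<in> A \<and> (\<forall>i::int. x [^] i \<in> A \<longrightarrow> int d dvd i)"
  proof (cases "\<exists>d::nat. d > 0 \<and> x [^] d \<in> A")
    case True
    define d where "d = (LEAST d::nat. d > 0 \<and> x [^] d \<in> A)"
    have d: "d > 0" "x [^] d \<in> A"
      using LeastI_ex[OF True] by (simp_all add: d_def)
    have "int d dvd i" if i: "x [^] i \<in> A" for i :: int
    proof -
      define r where "r = nat (i mod int d)"
      have r: "int r = i mod int d" "r < d"
        using d(1) by (simp_all add: r_def nat_less_iff)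
      have "x [^] (i - int d * (i div int d)) = x [^] i \<otimes> inv ((x [^] int d) [^] (i div int d))"
        using x(1) by (simp add: int_pow_diff int_pow_pow)
      also have "\<dots> \<in> A"
        using i d(2) A subgroup_int_pow_closed[OF A]
        by (simp add: subgroup.m_closed subgroup.m_inv_closed int_pow_int)
      finally have "x [^] r \<in> A"
        by (simp add: minus_mult_div_eq_mod int_pow_int flip: r(1))
      then have "r = 0" using not_less_Least[of r "\<lambda>d. d > 0 \<and> x [^] d \<in> A"] r(2) by (auto simp: d_def)
      then show ?thesis using r(1) by (simp add: dvd_eq_mod_eq_0)
    qed
    then show ?thesis using d by blast
  next
    case False
    have "i = 0" if i: "x [^] i \<in> A" for i :: int
    proof (rule ccontr)
      assume "i \<noteq> 0"
      have "x [^] (- i) \<in> A"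
        using subgroup.m_inv_closed[OF A i] x(1) by (simp add: int_pow_neg)
      then have "x [^] \<bar>i\<bar> \<in> A" using i by (simp add: abs_if)
      then have "x [^] nat \<bar>i\<bar> \<in> A" by (metis abs_ge_zero int_nat_eq int_pow_int nat_0_le)
      moreover have "0 < nat \<bar>i\<bar>" using \<open>i \<noteq> 0\<close> by simp
      ultimately show False using False by blast
    qed
    \<comment> \<open>When no positive exponent occurs, the exponent 0 serves: it divides only 0,
      the sole exponent left.\<close>
    then show ?thesis using subgroup.one_closed[OF A] by (intro exI[of _ 0]) auto
  qed
  then obtain d :: nat where d: "x [^] d \<in> A" "\<And>i::int. x [^] i \<in> A \<Longrightarrow> int d dvd i" by blast
  have "A = range (\<lambda>n::int. (x [^] d) [^] n)"
  proof (intro equalityI subsetI)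
    fix y assume y: "y \<in> A"
    then obtain i :: int where i: "y = x [^] i"
      using x(2) subgroup.mem_carrier[OF A] by blast
    then obtain j where "i = int d * j" using d(2) y by blast
    then have "y = (x [^] d) [^] j"
      using i x(1) by (metis int_pow_int int_pow_pow)
    then show "y \<in> range (\<lambda>n::int. (x [^] d) [^] n)" by blast
  qed (use subgroup_int_pow_closed[OF A d(1)] in auto)
  then show ?thesis
    unfolding A.cyclic_group using d(1) int_pow_consistent[OF A d(1)] by auto
qed

context group
begin

text \<open>Choose \<open>T\<close> Sylow in the normalizer of \<open>P\<close> and conjugate all of
  \<open>T\<close> into \<open>S\<close>, not just \<open>P\<close>. The image of \<open>T\<close>
  lies in the part of \<open>S\<close> normalizing the new subgroup; as the two normalizers have
  equal order, that part is Sylow. Taking \<open>P \<subseteq> T\<close> ensures that the conjugate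
  of \<open>P\<close> also lands in \<open>S\<close>.\<close>

lemma ex_fully_normalized_conjugate:
  assumes fin: "finite (carrier G)" and p: "Factorial_Ring.prime p" and S: "sylow_subgroup p G S"
    and P: "subgroup P G" "P \<subseteq> S"
  shows "\<exists>h\<in>carrier G. conjugate G h ` P \<subseteq> S \<and>
    sylow_subgroup p (subgrp G (normalizer_of G (conjugate G h ` P)))
      (S \<inter> normalizer_of G (conjugate G h ` P))"
proof -
  have Ss: "subgroup S G" "card S = p ^ multiplicity p (order G)"
    using S by (simp_all add: sylow_subgroup_def)
  let ?N = "\<lambda>P. normalizer_of G P"
  have finsub: "finite A" if "subgroup A G" for A
    using that fin finite_subset subgroup.subset by blast
  have ppow: "\<exists>e. card A = p ^ e" if "subgroup A G" "A \<subseteq> S" for A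
    using card_subgroup_dvd[OF fin that(1) Ss(1) that(2)] Ss(2) divides_primepow_nat[OF p] by auto
  note Pc = subgroup.subset[OF P(1)]
  have NP: "subgroup (?N P) G" by (rule normalizer_of_subgroup[OF Pc])
  interpret N: group "subgrp G (?N P)" by (rule subgroup_imp_group[OF NP])
  have "p_subgroup p (subgrp G (?N P)) P"
    using subgroup_incl[OF P(1) NP subgroup_le_normalizer_of[OF P(1)]] ppow[OF P]
    by (simp add: p_subgroup_def)
  then obtain T where T: "sylow_subgroup p (subgrp G (?N P)) T" "P \<subseteq> T"
    using N.sylow_superset[OF _ p] finsub[OF NP] by auto
  have TN: "T \<subseteq> ?N P" and Ts: "subgroup T G" and cT: "card T = p ^ multiplicity p (card (?N P))"
    using T incl_subgroup[OF NP] subgroup.subset by (force simp: sylow_subgroup_def order_def)+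
  obtain h where h: "h \<in> carrier G" "conjugate G h ` T \<subseteq> S"
    using sylow_conjugate[OF fin p S, of T] Ts cT by (auto simp: p_subgroup_def)
  let ?Q = "conjugate G h ` P"
  have Q: "subgroup ?Q G" by (rule subgroup_conjugate[OF h(1) P(1)])
  note Qc = subgroup.subset[OF Q]
  have NQ: "subgroup (?N ?Q) G" by (rule normalizer_of_subgroup[OF Qc])
  have Nc: "?N B \<subseteq> carrier G" for B by (auto simp: normalizer_of_def)
  have "card (?N P) \<le> card (?N ?Q)"
    using card_conjugate[OF h(1) Nc[of P]] card_mono[OF finsub[OF NQ] conjugate_normalizer_of[OF h(1) Pc]] by simp
  moreover have "card (?N ?Q) \<le> card (?N P)"
  proof -
    have "conjugate G (inv h) ` ?Q = P"
      using conjugate_image_mult[of h "inv h" P] h(1) Pc by simp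
    then have "conjugate G (inv h) ` ?N ?Q \<subseteq> ?N P"
      using conjugate_normalizer_of[of "inv h" ?Q] h(1) Qc by simp
    then show ?thesis
      using card_conjugate[of "inv h" "?N ?Q"] Nc[of ?Q] h(1) card_mono[OF finsub[OF NP]]
      by (metis inv_closed)
  qed
  ultimately have cN: "card (?N ?Q) = card (?N P)" by simp
  let ?V = "S \<inter> ?N ?Q"
  have V: "subgroup ?V G" using subgroups_Inter_pair[OF Ss(1) NQ] .
  obtain e where e: "card ?V = p ^ e" using ppow[OF V] by blast
  have "card (conjugate G h ` T) dvd card ?V"
    using h TN conjugate_normalizer_of[OF h(1) Pc] by (intro card_subgroup_dvd[OF fin subgroup_conjugate[OF h(1) Ts] V]) blast
  then have "p ^ multiplicity p (card (?N P)) dvd p ^ e"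
    using card_conjugate[OF h(1) subgroup.subset[OF Ts]] cT e by simp
  then have "multiplicity p (card (?N P)) \<le> e"
    using power_dvd_imp_le prime_gt_1_nat[OF p] by blast
  moreover have "e \<le> multiplicity p (card (?N ?Q))"
  proof (rule multiplicity_geI)
    show "p ^ e dvd card (?N ?Q)"
      using card_subgroup_dvd[OF fin V NQ] e by simp
    show "card (?N ?Q) \<noteq> 0"
      using finsub[OF NQ] subgroup.one_closed[OF NQ] by (metis card_0_eq empty_iff)
  qed (use p not_prime_unit in auto)
  ultimately have "e = multiplicity p (card (?N ?Q))" using cN by simp
  then have "sylow_subgroup p (subgrp G (?N ?Q)) ?V"
    using subgroup_incl[OF V NQ] e by (simp add: sylow_subgroup_def order_def)
  moreover have "?Q \<subseteq> S" using h(2) T(2) by blast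
  ultimately show ?thesis using h(1) by blast
qed

text \<open>This replaces Alperin's fusion theorem: every morphism between proper subgroups of \<open>S\<close> is
  extended to a larger subgroup by passing through a fully normalized conjugate.\<close>

lemma fusion_controlled_by_normalizer:
  assumes fin: "finite (carrier G)" and p: "Factorial_Ring.prime p" and S: "sylow_subgroup p G S"
    and fact: "\<And>Q l. \<lbrakk>subgroup Q G; Q \<subseteq> S; l \<in> normalizer_of G Q;
        sylow_subgroup p (subgrp G (normalizer_of G Q)) (S \<inter> normalizer_of G Q)\<rbrakk> \<Longrightarrow>
      \<exists>c\<in>centralizer_of G Q.
        conjugate G (l \<otimes> c) ` (S \<inter> normalizer_of G Q) = S \<inter> normalizer_of G Q"
    and P: "subgroup P G" "P \<subseteq> S" and g: "g \<in> carrier G" "conjugate G g ` P \<subseteq> S"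
  shows "\<exists>n\<in>normalizer_of G S. \<forall>x\<in>P. conjugate G n x = conjugate G g x"
  using P g
proof (induction "card S - card P" arbitrary: P g rule: less_induct)
  case less
  let ?N = "\<lambda>P. normalizer_of G P"
  have Ss: "subgroup S G" "card S = p ^ multiplicity p (order G)"
    using S by (simp_all add: sylow_subgroup_def)
  then have pS: "p_subgroup p G S" by (auto simp: p_subgroup_def)
  note Sc = subgroup.subset[OF Ss(1)]
  have finS: "finite S" using finite_subset[OF Sc fin] .
  have NS: "subgroup (?N S) G" by (rule normalizer_of_subgroup[OF Sc])
  note NSc = subgroup.mem_carrier[OF NS]
  show ?case
  proof (cases "P = S")
    case True
    then show ?thesis
      using normalizer_ofI[OF finS Sc less.prems(3)] less.prems(4) by blast
  next
    case False
    have IH: "\<exists>n\<in>?N S. \<forall>x\<in>A. conjugate G n x = conjugate G a x"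
      if "subgroup A G" "A \<subseteq> S" "a \<in> carrier G" "conjugate G a ` A \<subseteq> S" "card P < card A" for A a
    proof -
      \<comment> \<open>The measure is a truncated difference; this bound makes it decrease strictly
        when \<open>A\<close> is larger than \<open>P\<close>.\<close>
      have "card A \<le> card S" using that finS by (simp add: card_mono)
      then show ?thesis using less.hyps[OF _ that(1-4)] that(5) by simp
    qed
    have cP: "card P < card S"
      using less.prems(2) False finS by (simp add: psubset_card_mono psubsetI)
    obtain h where h: "h \<in> carrier G" "conjugate G h ` P \<subseteq> S"
      "sylow_subgroup p (subgrp G (?N (conjugate G h ` P))) (S \<inter> ?N (conjugate G h ` P))"
      using ex_fully_normalized_conjugate[OF fin p S less.prems(1,2)] by blast
    define Q where "Q = conjugate G h ` P"
    have Q: "subgroup Q G" unfolding Q_def by (rule subgroup_conjugate[OF h(1) less.prems(1)])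
    have QS: "Q \<subseteq> S" using h(2) by (simp add: Q_def)
    note Qc = subgroup.subset[OF Q]
    note Pc = subgroup.subset[OF less.prems(1)]
    have cQ: "card Q = card P" unfolding Q_def by (rule card_conjugate[OF h(1) Pc])
    have NQ: "subgroup (?N Q) G" by (rule normalizer_of_subgroup[OF Qc])
    interpret NQ: group "subgrp G (?N Q)" by (rule subgroup_imp_group[OF NQ])
    have finNQ: "finite (?N Q)" using finite_subset[OF subgroup.subset[OF NQ] fin] .
    let ?W = "S \<inter> ?N Q"
    have W: "sylow_subgroup p (subgrp G (?N Q)) ?W" using h(3) by (simp add: Q_def)
    have Ws: "subgroup ?W G" using subgroups_Inter_pair[OF Ss(1) NQ] .
    \<comment> \<open>Only the image is matched here, not the values on \<open>A\<close>. The
      element \<open>a\<close> maps the normalizer of \<open>A\<close> in \<open>S\<close> into that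
      of \<open>Q\<close>; a correction \<open>b\<close> normalizing \<open>Q\<close> brings this
      p-subgroup into \<open>S\<close>. The induction hypothesis applies because it is larger than
      \<open>A\<close>.\<close>
    have move: "\<exists>n\<in>?N S. conjugate G n ` A = Q"
      if A: "subgroup A G" "A \<subseteq> S" "card A = card P" and a: "a \<in> carrier G" "conjugate G a ` A = Q"
      for A a
    proof -
      note Ac = subgroup.subset[OF A(1)]
      let ?V = "S \<inter> ?N A"
      have NA: "subgroup (?N A) G" by (rule normalizer_of_subgroup[OF Ac])
      have V: "subgroup ?V G" using subgroups_Inter_pair[OF Ss(1) NA] .
      note Vc = subgroup.subset[OF V]
      have "A \<subset> S" using A cP by auto
      then have cV: "card P < card ?V"
        using normalizer_grows_in_p_subgroup[OF fin p pS A(1)] A(3) by simp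
      have aVN: "conjugate G a ` ?V \<subseteq> ?N Q"
        using conjugate_normalizer_of[OF a(1) Ac] a(2) by blast
      note aV = subgroup_conjugate[OF a(1) V]
      have "card (conjugate G a ` ?V) dvd p ^ multiplicity p (order G)"
        using card_conjugate[OF a(1) Vc] card_subgroup_dvd[OF fin V Ss(1)] Ss(2) by simp
      then have "p_subgroup p (subgrp G (?N Q)) (conjugate G a ` ?V)"
        using divides_primepow_nat[OF p] subgroup_incl[OF aV NQ aVN] by (auto simp: p_subgroup_def)
      then have "\<exists>b\<in>?N Q. conjugate (subgrp G (?N Q)) b ` conjugate G a ` ?V \<subseteq> ?W"
        using NQ.sylow_conjugate[OF _ p W, of "conjugate G a ` ?V"] finNQ by simp
      then obtain b where b: "b \<in> ?N Q" "conjugate (subgrp G (?N Q)) b ` conjugate G a ` ?V \<subseteq> ?W"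
        by blast
      have bc: "b \<in> carrier G" and bQ: "conjugate G b ` Q = Q"
        using b(1) by (simp_all add: normalizer_of_def)
      have "conjugate G b ` conjugate G a ` ?V \<subseteq> S"
        using b conjugate_subgrp[OF NQ b(1)] by auto
      then have "conjugate G (a \<otimes> b) ` ?V \<subseteq> S"
        using conjugate_image_mult[OF a(1) bc Vc] by simp
      then obtain n where n: "n \<in> ?N S" "\<forall>x\<in>?V. conjugate G n x = conjugate G (a \<otimes> b) x"
        using IH[OF V _ _ _ cV, of "a \<otimes> b"] a(1) bc by blast
      have "A \<subseteq> ?V" using A(2) subgroup_le_normalizer_of[OF A(1)] by blast
      then have "conjugate G n ` A = conjugate G (a \<otimes> b) ` A"
        using n(2) by (intro image_cong) auto
      also have "\<dots> = Q" using conjugate_image_mult[OF a(1) bc Ac] a(2) bQ by simp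
      finally show ?thesis using n(1) by blast
    qed
    obtain n1 where n1: "n1 \<in> ?N S" "conjugate G n1 ` P = Q"
      using move[OF less.prems(1,2) refl h(1)] by (auto simp: Q_def)
    define P2 where "P2 = conjugate G g ` P"
    have P2: "subgroup P2 G" "P2 \<subseteq> S" "card P2 = card P"
      using subgroup_conjugate[OF less.prems(3,1)] less.prems(4) card_conjugate[OF less.prems(3) Pc]
      by (simp_all add: P2_def)
    note gc = less.prems(3)
    have "conjugate G (inv g \<otimes> h) ` P2 = Q"
    proof -
      have "conjugate G (inv g \<otimes> h) ` P2 = conjugate G (g \<otimes> (inv g \<otimes> h)) ` P"
        unfolding P2_def using gc h(1) Pc by (intro conjugate_image_mult[symmetric]) simp_all
      also have "g \<otimes> (inv g \<otimes> h) = h" using gc h(1) by (simp flip: m_assoc)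
      finally show ?thesis by (simp add: Q_def)
    qed
    then obtain n2 where n2: "n2 \<in> ?N S" "conjugate G n2 ` P2 = Q"
      using move[OF P2, of "inv g \<otimes> h"] gc h(1) by auto
    note n1c = NSc[OF n1(1)] and n2c = NSc[OF n2(1)]
    \<comment> \<open>The discrepancy between \<open>g\<close> and the elements \<open>n1\<close>,
      \<open>n2\<close> of the normalizer of \<open>S\<close>. Both \<open>n1\<close> and
      \<open>g \<otimes> n2\<close> map \<open>P\<close> onto \<open>Q\<close>, so \<open>l\<close>
      normalizes \<open>Q\<close>, and it remains to realize its action on \<open>Q\<close> inside
      the normalizer of \<open>S\<close>.\<close>
    define l where "l = inv n1 \<otimes> g \<otimes> n2"
    have lc: "l \<in> carrier G" using n1c n2c gc by (simp add: l_def)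
    have n1l: "n1 \<otimes> l = g \<otimes> n2" using n1c n2c gc by (simp add: l_def m_assoc flip: m_assoc[of n1])
    have "conjugate G l ` Q = conjugate G (g \<otimes> n2) ` P"
      using conjugate_image_mult[OF n1c lc Pc] n1(2) n1l by simp
    also have "\<dots> = Q" using conjugate_image_mult[OF gc n2c Pc] n2(2) by (simp add: P2_def)
    finally have lQ: "conjugate G l ` Q = Q" .
    then have lN: "l \<in> ?N Q" using lc by (simp add: normalizer_of_def)
    then obtain c where c: "c \<in> centralizer_of G Q" "conjugate G (l \<otimes> c) ` ?W = ?W"
      using fact[OF Q QS _ W] by blast
    have cc: "c \<in> carrier G" using c by (simp add: centralizer_of_def)
    have "Q \<subset> S" using QS cQ cP by auto
    \<comment> \<open>The element \<open>l \<otimes> c\<close> acts on \<open>Q\<close> as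
      \<open>l\<close> does and maps \<open>?W\<close> to itself, so the induction hypothesis for
      \<open>?W\<close> yields \<open>n3\<close> with this action. Replacing \<open>l\<close> by
      \<open>n3\<close> in the factorization of \<open>g\<close> gives the required element.\<close>
    then have "card P < card ?W"
      using normalizer_grows_in_p_subgroup[OF fin p pS Q] cQ by simp
    then obtain n3 where n3: "n3 \<in> ?N S" "\<forall>x\<in>?W. conjugate G n3 x = conjugate G (l \<otimes> c) x"
      using IH[OF Ws, of "l \<otimes> c"] lc cc c(2) by auto
    note n3c = NSc[OF n3(1)]
    have n3l: "conjugate G n3 y = conjugate G l y" if y: "y \<in> Q" for y
    proof -
      have "y \<in> ?W" using y QS subgroup_le_normalizer_of[OF Q] by blast
      then have "conjugate G n3 y = conjugate G c (conjugate G l y)"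
        using n3(2) conjugate_conjugate[OF lc cc] y Qc by auto
      also have "\<dots> = conjugate G l y"
        using c(1) lQ y by (auto simp: centralizer_of_def)
      finally show ?thesis .
    qed
    have "conjugate G (n1 \<otimes> n3 \<otimes> inv n2) x = conjugate G g x" if x: "x \<in> P" for x
    proof -
      have xc: "x \<in> carrier G" using x Pc by blast
      have "conjugate G n3 (conjugate G n1 x) = conjugate G l (conjugate G n1 x)"
        using n3l n1(2) x by blast
      also have "\<dots> = conjugate G n2 (conjugate G g x)"
        using n1l conjugate_conjugate[OF n1c lc xc] conjugate_conjugate[OF gc n2c xc] by simp
      finally show ?thesis
        using n1c n2c n3c gc xc by (simp add: conjugate_conjugate)
    qed
    moreover have "n1 \<otimes> n3 \<otimes> inv n2 \<in> ?N S"
      using n1(1) n2(1) n3(1) NS by (simp add: subgroup.m_closed subgroup.m_inv_closed)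
    ultimately show ?thesis by blast
  qed
qed

text \<open>A chief factor is split off at the top; the series of the smaller normal subgroup is
  then extended by \<open>N\<close> at the next index.\<close>

lemma cyclic_chief_series:
  assumes fin: "finite (carrier G)" and N: "N \<lhd> G"
    and cyc: "\<And>H K. chief_factor G H K \<Longrightarrow> H \<subseteq> N \<Longrightarrow> cyclic_mod G H K"
  shows "\<exists>(n::nat) T. T 0 = {\<one>} \<and> T n = N \<and> (\<forall>i\<le>n. T i \<lhd> G) \<and>
    (\<forall>i<n. T i \<subseteq> T (Suc i) \<and> cyclic_mod G (T (Suc i)) (T i))"
  using N cyc
proof (induction "card N" arbitrary: N rule: less_induct)
  case less
  show ?case
  proof (cases "N = {\<one>}")
    case True
    then show ?thesis
      using one_is_normal by (intro exI[of _ "0::nat"] exI[of _ "\<lambda>_. {\<one>}"]) auto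
  next
    case False
    then obtain K where ch: "chief_factor G N K"
      using ex_chief_factor[OF fin less.prems(1)] by blast
    note c = chief_factorD[OF ch]
    have "finite N" using finite_subset[OF subgroup.subset[OF normal_imp_subgroup[OF less.prems(1)]] fin] .
    then have "card K < card N" using c(3) by (rule psubset_card_mono)
    moreover have "cyclic_mod G H J" if "chief_factor G H J" "H \<subseteq> K" for H J
      using less.prems(2)[OF that(1)] that(2) c(3) by blast
    ultimately obtain n :: nat and T where T: "T 0 = {\<one>}" "T n = K" "\<forall>i\<le>n. T i \<lhd> G"
      "\<forall>i<n. T i \<subseteq> T (Suc i) \<and> cyclic_mod G (T (Suc i)) (T i)"
      using less.hyps[OF _ c(2)] by blast
    let ?T = "T(Suc n := N)"
    have "\<forall>i<Suc n. ?T i \<subseteq> ?T (Suc i) \<and> cyclic_mod G (?T (Suc i)) (?T i)"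
      using T(2,4) c(3) less.prems(2)[OF ch] by (auto simp: less_Suc_eq)
    moreover have "\<forall>i\<le>Suc n. ?T i \<lhd> G"
      using T(3) less.prems(1) by (auto simp: le_Suc_eq)
    ultimately show ?thesis
      using T(1) by (intro exI[of _ "Suc n"] exI[of _ ?T]) auto
  qed
qed

end

theorem theorem3p24:
  fixes R :: "'a set \<Rightarrow> 'a monoid \<Rightarrow> bool"
    and G :: "'a monoid"
    and p :: nat
    and S :: "'a set"
  assumes "semi_3_eternal R"
    and "group G"
    and "finite (carrier G)"
    and "Factorial_Ring.prime p"
    and "p dvd order G"
    and "sylow_subgroup p G S"
    and "\<And>H. subgroup H (subgrp G S) \<Longrightarrow> card H = p \<Longrightarrow> R H G"
    and "\<And>H. p_subgroup 2 G S \<Longrightarrow> \<not> cyclic_group (subgrp G S) \<Longrightarrow>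
           subgroup H (subgrp G S) \<Longrightarrow> cyclic_group (subgrp G H) \<Longrightarrow> card H = 4 \<Longrightarrow> R H G"
  shows "supersolvable_fusion (subgrp G S) (group_fusion G S)"
proof -
  interpret group G by fact
  note fin = \<open>finite (carrier G)\<close> and p = \<open>Factorial_Ring.prime p\<close>
    and S = \<open>sylow_subgroup p G S\<close>
  have Ss: "subgroup S G" "card S = p ^ multiplicity p (order G)"
    using S by (simp_all add: sylow_subgroup_def)
  note Sc = subgroup.subset[OF Ss(1)]
  interpret S: group "subgrp G S" by (rule subgroup_imp_group[OF Ss(1)])

  \<comment> \<open>The only place where the relation is used. It serves twice: for normalizers of
    fully normalized subgroups, to control fusion, and for the normalizer of \<open>S\<close>, to
    obtain the final series.\<close>
  have chief: "cyclic_mod (subgrp G L) H K"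
    if L: "subgroup L G" and SL: "sylow_subgroup p (subgrp G L) (S \<inter> L)"
      and ch: "chief_factor (subgrp G L) H K" and Hp: "p_subgroup p (subgrp G L) H"
    for L H K
  proof -
    let ?L = "subgrp G L"
    interpret L: group ?L by (rule subgroup_imp_group[OF L])
    have finL: "finite (carrier ?L)" using finite_subset[OF subgroup.subset[OF L] fin] by simp
    let ?O = "p_core p ?L"
    note O = L.p_core_properties[OF finL p]
    note c = L.chief_factorD[OF ch]
    have HO: "H \<subseteq> ?O" using O(3)[OF c(1) Hp] .
    have "?O \<subseteq> S \<inter> L"
    proof
      obtain g where g: "g \<in> carrier ?L" "conjugate ?L g ` ?O \<subseteq> S \<inter> L"
        using L.sylow_conjugate[OF finL p SL O(2)] by blast
      fix x assume x: "x \<in> ?O"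
      then have xc: "x \<in> carrier ?L" using normal_imp_subgroup[OF O(1)] subgroup.mem_carrier by fast
      have "conjugate ?L (inv\<^bsub>?L\<^esub> g) x \<in> ?O"
        by (rule L.normal_conjugate[OF O(1) L.inv_closed[OF g(1)] x])
      moreover have "x = conjugate ?L g (conjugate ?L (inv\<^bsub>?L\<^esub> g) x)"
        using L.conjugate_inv_cancel(2)[OF g(1) xc] by simp
      ultimately show "x \<in> S \<inter> L" using g(2) by blast
    qed
    then have OS: "?O \<subseteq> S" by blast
    have Os: "subgroup ?O G" using incl_subgroup[OF L normal_imp_subgroup[OF O(1)]] .
    have OsS: "subgroup ?O (subgrp G S)" by (rule subgroup_incl[OF Os Ss(1) OS])
    have HsO: "subgroup A G" "A \<subseteq> S" "subgroup A (subgrp G S)" "subgroup A ?L"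
      if "subgroup A (subgrp G ?O)" for A
    proof -
      have A: "A \<subseteq> ?O" using subgroup.subset[OF that] by simp
      show "subgroup A G" by (rule incl_subgroup[OF Os that])
      then show "A \<subseteq> S" "subgroup A (subgrp G S)" "subgroup A ?L"
        using A OS subgroup.subset[OF normal_imp_subgroup[OF O(1)]] Ss(1) L
        by (auto intro!: subgroup_incl)
    qed
    \<comment> \<open>Condition (0) carries the relation from \<open>G\<close> down to
      \<open>L\<close>.\<close>
    have down: "R A ?L" if "R A G" "subgroup A ?L" for A
      using \<open>semi_3_eternal R\<close> is_group fin L that unfolding semi_3_eternal_def by blast
    obtain e where e: "card ?O = p ^ e" using O(2) by (auto simp: p_subgroup_def)
    have "card K < card H"
      using c(3) finite_subset[OF subgroup.subset[OF normal_imp_subgroup[OF c(1)]] finL]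
      by (simp add: psubset_card_mono)
    moreover have "card K > 0"
      using subgroup.finite_imp_card_positive[OF normal_imp_subgroup[OF c(2)] finL] .
    ultimately have "card H > 1" by simp
    moreover have "finite ?O"
      using finite_subset[OF subgroup.subset[OF Os] fin] .
    \<comment> \<open>A chief factor below O_p(L) makes it nontrivial. This gives that p divides the
      order of \<open>L\<close>, and later that O_p(L) can be a 2-group only for p = 2.\<close>
    ultimately have O1: "card ?O > 1" using card_mono[OF _ HO] by fastforce
    then have e0: "e > 0" using e by (cases e) auto
    then have "p dvd card ?O" using e by simp
    also have "card ?O dvd order ?L"
      using L.card_subgroup_dvd[OF finL normal_imp_subgroup[OF O(1)] L.subgroup_self]
        subgroup.subset[OF normal_imp_subgroup[OF O(1)]] by (simp add: order_def)
    finally have pL: "p dvd order ?L" .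
    have R1: "R A ?L" if "subgroup A (subgrp ?L ?O)" "card A = p" for A
      using that HsO[of A] assms(7)[of A] down by simp
    have R2: "R A ?L"
      if nc: "\<not> cyclic_group (subgrp ?L ?O)" and two: "p_subgroup 2 ?L ?O"
        and A: "subgroup A (subgrp ?L ?O)" "cyclic_group (subgrp ?L A)" "card A = 4" for A
    proof -
      obtain f where f: "card ?O = 2 ^ f" using two by (auto simp: p_subgroup_def)
      then have "p dvd 2 ^ f" using e e0 by (metis dvd_power)
      then have "p dvd 2" using p prime_dvd_power by blast
      then have "p = 2" using p by (simp add: primes_dvd_imp_eq two_is_prime_nat)
      then have "p_subgroup 2 G S" using Ss by (auto simp: p_subgroup_def)
      moreover have "\<not> cyclic_group (subgrp G S)"
        using S.subgroup_of_cyclic_group[OF _ OsS] nc by auto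
      ultimately show ?thesis using A HsO[of A] assms(8)[of A] down by simp
    qed
    have "?O \<subseteq> supersolvable_hypercenter ?L"
      using \<open>semi_3_eternal R\<close> L.is_group finL p pL R1 R2 unfolding semi_3_eternal_def by blast
    then show ?thesis
      using L.hypercentral_supersolvable_hypercenter[OF finL] ch HO
      unfolding hypercentral_def by blast
  qed

  have fact: "\<exists>c\<in>centralizer_of G Q.
      conjugate G (l \<otimes>\<^bsub>G\<^esub> c) ` (S \<inter> normalizer_of G Q) = S \<inter> normalizer_of G Q"
    if Q: "subgroup Q G" "Q \<subseteq> S" and l: "l \<in> normalizer_of G Q"
      and W: "sylow_subgroup p (subgrp G (normalizer_of G Q)) (S \<inter> normalizer_of G Q)" for Q l
  proof -
    let ?N = "normalizer_of G Q"
    let ?L = "subgrp G ?N"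
    have N: "subgroup ?N G" by (rule normalizer_of_subgroup[OF subgroup.subset[OF Q(1)]])
    interpret L: group ?L by (rule subgroup_imp_group[OF N])
    have finL: "finite (carrier ?L)" using finite_subset[OF subgroup.subset[OF N] fin] by simp
    have Qn: "Q \<lhd> ?L" by (rule normal_in_normalizer_of[OF Q(1)])
    have pp: "p_subgroup p ?L A" if "subgroup A ?L" "A \<subseteq> Q" for A
    proof -
      have "card A dvd p ^ multiplicity p (order G)"
        using card_subgroup_dvd[OF fin incl_subgroup[OF N that(1)] Ss(1)] that(2) Q(2) Ss(2) by auto
      then show ?thesis using divides_primepow_nat[OF p] that(1) by (auto simp: p_subgroup_def)
    qed
    have "cyclic_mod ?L H K" if ch: "chief_factor ?L H K" "H \<subseteq> Q" for H K
      using chief[OF N W ch(1) pp[OF normal_imp_subgroup[OF L.chief_factorD(1)[OF ch(1)]] ch(2)]] .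
    then obtain c where c: "c \<in> centralizer_of ?L Q"
        "conjugate ?L (l \<otimes>\<^bsub>?L\<^esub> c) ` (S \<inter> ?N) = S \<inter> ?N"
      using L.sylow_normalizer_centralizer_factorization[OF finL p Qn
          pp[OF normal_imp_subgroup[OF Qn] subset_refl] _ W, of l] l by auto
    have cN: "c \<in> ?N" using c(1) by (simp add: centralizer_of_def)
    then have "c \<in> centralizer_of G Q"
      using c(1) conjugate_subgrp[OF N cN] subgroup.mem_carrier[OF N] by (simp add: centralizer_of_def)
    moreover have "conjugate G (l \<otimes>\<^bsub>G\<^esub> c) ` (S \<inter> ?N) = S \<inter> ?N"
      using c(2) conjugate_subgrp[OF N subgroup.m_closed[OF N l cN]] by simp
    ultimately show ?thesis by blast
  qed
  note control = fusion_controlled_by_normalizer[OF fin p S fact]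

  let ?N = "normalizer_of G S"
  let ?L = "subgrp G ?N"
  have N: "subgroup ?N G" by (rule normalizer_of_subgroup[OF Sc])
  interpret L: group ?L by (rule subgroup_imp_group[OF N])
  have finL: "finite (carrier ?L)" using finite_subset[OF subgroup.subset[OF N] fin] by simp
  have SN: "S \<subseteq> ?N" by (rule subgroup_le_normalizer_of[OF Ss(1)])
  have Sn: "S \<lhd> ?L" by (rule normal_in_normalizer_of[OF Ss(1)])
  \<comment> \<open>\<open>S\<close> is normal in \<open>?L\<close>, so every chief factor below
    \<open>S\<close> falls under \<open>chief\<close>.\<close>
  have W: "sylow_subgroup p ?L (S \<inter> ?N)"
    using sylow_in_subgroup[OF fin S N SN p] SN by (simp add: Int_absorb2)
  have cyc: "cyclic_mod ?L H K" if ch: "chief_factor ?L H K" "H \<subseteq> S" for H K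
  proof (rule chief[OF N W ch(1)])
    have H: "subgroup H ?L" using normal_imp_subgroup[OF L.chief_factorD(1)[OF ch(1)]] .
    then have "card H dvd p ^ multiplicity p (order G)"
      using card_subgroup_dvd[OF fin incl_subgroup[OF N H] Ss(1) ch(2)] Ss(2) by simp
    then show "p_subgroup p ?L H" using divides_primepow_nat[OF p] H by (auto simp: p_subgroup_def)
  qed
  have "\<exists>(n::nat) T. T 0 = {\<one>\<^bsub>?L\<^esub>} \<and> T n = S \<and> (\<forall>i\<le>n. T i \<lhd> ?L) \<and>
      (\<forall>i<n. T i \<subseteq> T (Suc i) \<and> cyclic_mod ?L (T (Suc i)) (T i))"
    by (rule L.cyclic_chief_series[OF finL Sn cyc])
  then obtain n :: nat and T where "T 0 = {\<one>\<^bsub>?L\<^esub>} \<and> T n = S \<and> (\<forall>i\<le>n. T i \<lhd> ?L) \<and>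
      (\<forall>i<n. T i \<subseteq> T (Suc i) \<and> cyclic_mod ?L (T (Suc i)) (T i))"
    by (elim exE)
  then have T: "T 0 = {\<one>\<^bsub>?L\<^esub>}" "T n = S" "\<And>i. i \<le> n \<Longrightarrow> T i \<lhd> ?L"
    "\<And>i. i < n \<Longrightarrow> T i \<subseteq> T (Suc i)" "\<And>i. i < n \<Longrightarrow> cyclic_mod ?L (T (Suc i)) (T i)"
    by simp_all
  have TS: "T i \<subseteq> S" if "i \<le> n" for i
    using that
  proof (induction rule: inc_induct)
    case (step m)
    then show ?case using T(4)[of m] by blast
  qed (simp add: T(2))
  have TG: "subgroup (T i) G" if "i \<le> n" for i
    using incl_subgroup[OF N normal_imp_subgroup[OF T(3)[OF that]]] .
  have "strongly_closed (subgrp G S) (group_fusion G S) (T i)" if i: "i \<le> n" for i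
    unfolding strongly_closed_def
  proof (intro conjI allI impI ballI)
    show "subgroup (T i) (subgrp G S)" by (rule subgroup_incl[OF TG[OF i] Ss(1) TS[OF i]])
    fix P \<phi>
    assume P': "subgroup P (subgrp (subgrp G S) (T i))"
      and \<phi>': "\<phi> \<in> group_fusion G S P (carrier (subgrp G S))"
    have P: "subgroup P (subgrp G (T i))" using P' by simp
    have "conjugate G g = (\<lambda>x. inv\<^bsub>G\<^esub> g \<otimes>\<^bsub>G\<^esub> x \<otimes>\<^bsub>G\<^esub> g)" for g
      by (simp add: conjugate_def fun_eq_iff)
    then obtain g where g: "g \<in> carrier G" and \<phi>: "\<phi> = restrict (conjugate G g) P" "\<phi> ` P \<subseteq> S"
      using \<phi>' unfolding group_fusion_def by auto
    have PT: "P \<subseteq> T i" using subgroup.subset[OF P] by simp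
    have img: "\<phi> ` P = conjugate G g ` P" using \<phi>(1) by simp
    then obtain m where m: "m \<in> ?N" "\<forall>x\<in>P. conjugate G m x = conjugate G g x"
      using control[OF _ _ _ _ incl_subgroup[OF TG[OF i] P] _ g] PT TS[OF i] \<phi>(2) by auto
    \<comment> \<open>The morphism given by \<open>g\<close> agrees on \<open>P\<close> with
      conjugation by \<open>m\<close>, and \<open>T i\<close> is normal in the normalizer of
      \<open>S\<close>, which contains \<open>m\<close>.\<close>
    have "conjugate G m x \<in> T i" if "x \<in> P" for x
      using L.normal_conjugate[OF T(3)[OF i], of m x] m(1) that PT conjugate_subgrp[OF N m(1)] by auto
    then show "\<phi> ` P \<subseteq> T i" unfolding img using m(2) by auto
  qed
  moreover have "T i \<lhd> subgrp (subgrp G S) (T (Suc i)) \<and>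
      cyclic_group (subgrp (subgrp G S) (T (Suc i)) Mod T i)" if i: "i < n" for i
  proof -
    have Ts: "subgroup (T (Suc i)) ?L" using normal_imp_subgroup[OF T(3)] i by simp
    have norm: "T i \<lhd> subgrp ?L (T (Suc i))"
      using L.normal_restrict_supergroup[OF Ts T(3) T(4)[OF i]] i by simp
    \<comment> \<open>The restriction to \<open>T (Suc i)\<close> is the same group whether taken
      inside \<open>S\<close> or inside the normalizer of \<open>S\<close>, so cyclicity transfers
      directly.\<close>
    then show ?thesis
      using L.cyclic_group_Mod_iff[OF Ts norm] T(5)[OF i] by simp
  qed
  ultimately show ?thesis
    unfolding supersolvable_fusion_def using T(1,2) by (intro exI[of _ n] exI[of _ T]) simp
qed

end
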